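(* There exists an increasing function $\varepsilon$, defined on the set of prime powers $q \geq 2$ and with real values, such that $$1.52 < \varepsilon(2) \leq \varepsilon(q) \leq \sqrt{2} + \frac{1}{2} \quad \text{for every prime power } q,$$ and such that for every prime power $q$ there is an integer $k_0(q)$ with $$m(k,q) \geq (q + \varepsilon(q))\cdot k \quad \text{for all integers } k \geq k_0(q).$$
   Context: For a prime power $q$, $\mathbb{F}_q$ is the field with $q$ elements. An $[n,k]_q$-code is a linear subspace of $\mathbb{F}_q^n$ of dimension $k$; $n$ is its length. The support of $x \in \mathbb{F}_q^n$ is $\sigma(x) = \{i \mid x_i \neq 0\}$. A nonzero codeword $c$ of a code $\mathcal{C}$ is minimal if there is no nonzero codeword $c' \in \mathcal{C}$ with $\sigma(c') \subsetneq \sigma(c)$. A code is minimal if all of its nonzero codewords are minimal. For an integer $k \geq 1$, $m(k,q)$ denotes the length of the shortest minimal codes of dimension $k$ over $\mathbb{F}_q$, i.e. the smallest $n$ such that there is a minimal $[n,k]_q$-code. *)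

theory Defs
  imports Complex_Main "HOL-Number_Theory.Prime_Powers"
    "Jordan_Normal_Form.Missing_VectorSpace"
begin

text \<open>
  The space \<open>F\<^sup>n\<close> is the library's space of functions from \<open>{..<n}\<close> to the carrier of \<open>F\<close>
  with pointwise operations; coordinates are numbered from \<open>0\<close>.
\<close>

abbreviation word_space :: "'a ring \<Rightarrow> nat \<Rightarrow> ('a, nat \<Rightarrow> 'a) module" where
  "word_space F n \<equiv> ring.func_space F {..<n}"

definition linear_code :: "'a ring \<Rightarrow> nat \<Rightarrow> nat \<Rightarrow> (nat \<Rightarrow> 'a) set \<Rightarrow> bool" where
  "linear_code F n k C \<longleftrightarrow>
     VectorSpace.subspace F C (word_space F n) \<and>
     vectorspace.dim F ((word_space F n)\<lparr>carrier := C\<rparr>) = k"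

definition support :: "'a ring \<Rightarrow> nat \<Rightarrow> (nat \<Rightarrow> 'a) \<Rightarrow> nat set" where
  "support F n x = {i \<in> {..<n}. x i \<noteq> \<zero>\<^bsub>F\<^esub>}"

definition minimal_codeword ::
    "'a ring \<Rightarrow> nat \<Rightarrow> (nat \<Rightarrow> 'a) set \<Rightarrow> (nat \<Rightarrow> 'a) \<Rightarrow> bool" where
  "minimal_codeword F n C c \<longleftrightarrow>
     c \<in> C \<and> c \<noteq> \<zero>\<^bsub>word_space F n\<^esub> \<and>
     \<not> (\<exists>c'\<in>C. c' \<noteq> \<zero>\<^bsub>word_space F n\<^esub> \<and> support F n c' \<subset> support F n c)"

definition minimal_code :: "'a ring \<Rightarrow> nat \<Rightarrow> (nat \<Rightarrow> 'a) set \<Rightarrow> bool" where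
  "minimal_code F n C \<longleftrightarrow>
     (\<forall>c\<in>C. c \<noteq> \<zero>\<^bsub>word_space F n\<^esub> \<longrightarrow> minimal_codeword F n C c)"

text \<open>
  The quantity \<open>m(k,q)\<close>, computed in a given field \<open>F\<close> with \<open>q\<close> elements.  It depends only on
  \<open>q\<close>, since any two such fields are isomorphic.
\<close>

definition min_code_length :: "nat \<Rightarrow> 'a ring \<Rightarrow> nat" where
  "min_code_length k F = (LEAST n. \<exists>C. linear_code F n k C \<and> minimal_code F n C)"

end

theory Submission
  imports Defs "HOL-Algebra.Multiplicative_Group" "HOL-Analysis.Complex_Transcendental"
begin

text \<open>
  By Jamison's polynomial argument, every nonzero codeword of a minimal code of dimension \<open>k\<close> has
  weight at least \<open>(q - 1)(k - 1) + 1\<close>.  A code of length \<open>n < (q + \<epsilon>) k\<close> therefore has rate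
  above \<open>1/(q + \<epsilon>)\<close> and relative distance about \<open>(q - 1)/(q + \<epsilon>)\<close> or more, which for
  \<open>\<epsilon> \<le> 1.521\<close> contradicts the first linear programming bound of McEliece, Rodemich, Rumsey and
  Welch for large \<open>k\<close>.  For linear codes that bound has an elementary proof in the spirit of
  Friedman and Tillich: in the Cayley graph of \<open>F\<^sup>n / C\<^sup>\<bottom>\<close> generated by the words of
  weight one, a large minimum distance makes the nontrivial eigenvalues small, while pushing forward
  a function supported on a Hamming ball yields a large Rayleigh quotient; hence \<open>C\<close> is not much
  larger than the ball.  Characters are avoided by expanding the quadratic form over the level sets of
  the functionals \<open>x \<mapsto> c \<bullet> x\<close>.  Since one constant works for all \<open>q\<close>, any increasing function
  with values between \<open>1.52\<close> and \<open>1.521\<close> can be taken as \<open>\<epsilon>\<close>.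
\<close>

section \<open>The linear programming bound\<close>

text \<open>Everything turns on the relative radius \<open>rho\<close> of the Hamming ball. It must
  be large enough for the Rayleigh quotient to exceed the nontrivial eigenvalues (spectral
  condition), yet the ball must contain fewer than about \<open>q^k\<close> words (entropy
  condition). With \<open>rho = (q - 1) c / (q (q + E))\<close> the spectral condition becomes
  \<open>(E - c)\<^sup>2 < 4 c\<close>: \<open>q\<close> drops out, so one constant can serve every
  \<open>q\<close>. For large \<open>q\<close> the entropy condition tends to
  \<open>2 c < 1\<close>; the two then allow \<open>E < c + 2 sqrt c\<close>, whose supremum
  \<open>sqrt 2 + 1/2\<close> is the upper bound in the theorem. For \<open>q = 2\<close> they allow
  \<open>E\<close> only up to about 1.527, so there is little room above 1.52. Factors polynomial in
  \<open>n\<close> may be lost freely, since only the exponential rate counts.\<close>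

lemma sum_square_le_card:
  fixes g :: "'b \<Rightarrow> real"
  assumes "finite A"
  shows "(\<Sum>x\<in>A. g x)\<^sup>2 \<le> card A * (\<Sum>x\<in>A. (g x)\<^sup>2)"
proof -
  have "0 \<le> (\<Sum>x\<in>A. \<Sum>y\<in>A. (g x - g y)\<^sup>2)" by (intro sum_nonneg) simp
  also have "\<dots> = (\<Sum>x\<in>A. \<Sum>y\<in>A. (g x)\<^sup>2 + (g y)\<^sup>2 - 2 * (g x * g y))"
    by (simp add: power2_diff algebra_simps)
  also have "\<dots> = 2 * (card A * (\<Sum>x\<in>A. (g x)\<^sup>2)) - 2 * (\<Sum>x\<in>A. g x)\<^sup>2"
    by (simp add: sum.distrib sum_subtractf sum_distrib_left[symmetric] power2_eq_square sum_product)
  finally show ?thesis by simp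
qed

text \<open>Grouping by the value of \<open>h\<close> turns a collision form into a sum of squares.
  This serves both for the level sets of a single functional and for the classes of words modulo the
  dual code.\<close>

lemma sum_collisions:
  fixes f :: "'b \<Rightarrow> real"
  assumes "finite X" "finite T" "h ` X \<subseteq> T"
  shows "(\<Sum>x\<in>X. \<Sum>y\<in>X. f x * f y * of_bool (h x = h y)) =
    (\<Sum>t\<in>T. (\<Sum>x\<in>X. f x * of_bool (h x = t))\<^sup>2)"
proof -
  have "(\<Sum>t\<in>T. (\<Sum>x\<in>X. f x * of_bool (h x = t))\<^sup>2) =
    (\<Sum>t\<in>T. \<Sum>x\<in>X. \<Sum>y\<in>X. (f x * of_bool (h x = t)) * (f y * of_bool (h y = t)))"
    by (simp only: power2_eq_square sum_product)
  also have "\<dots> = (\<Sum>x\<in>X. \<Sum>t\<in>T. \<Sum>y\<in>X. (f x * of_bool (h x = t)) * (f y * of_bool (h y = t)))"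
    by (rule sum.swap)
  also have "\<dots> = (\<Sum>x\<in>X. \<Sum>y\<in>X. \<Sum>t\<in>T. (f x * of_bool (h x = t)) * (f y * of_bool (h y = t)))"
    by (intro sum.cong refl sum.swap)
  also have "\<dots> = (\<Sum>x\<in>X. \<Sum>y\<in>X. f x * f y * of_bool (h x = h y))"
  proof (intro sum.cong refl)
    fix x y assume x: "x \<in> X" and y: "y \<in> X"
    have "(\<Sum>t\<in>T. (f x * of_bool (h x = t)) * (f y * of_bool (h y = t))) =
      (\<Sum>t\<in>T. if h x = t then f x * f y * of_bool (h x = h y) else 0)"
      by (intro sum.cong) auto
    also have "\<dots> = f x * f y * of_bool (h x = h y)" using assms x by (subst sum.delta') auto
    finally show "(\<Sum>t\<in>T. (f x * of_bool (h x = t)) * (f y * of_bool (h y = t))) =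
      f x * f y * of_bool (h x = h y)" .
  qed
  finally show ?thesis by simp
qed

text \<open>A code \<open>C\<close> paired with the words \<open>X\<close>, as far as the linear programming bound is
  concerned; \<open>o'\<close> is the zero codeword and \<open>nz c i\<close> says that the \<open>i\<close>-th coordinate of \<open>c\<close> is nonzero.\<close>

locale code_pairing =
  fixes n :: nat and K :: "'a set" and X :: "(nat \<Rightarrow> 'a) set" and C :: "'c set"
    and ip :: "'c \<Rightarrow> (nat \<Rightarrow> 'a) \<Rightarrow> 'a" and nz :: "'c \<Rightarrow> nat \<Rightarrow> bool" and o' :: 'c and d :: nat
  assumes finite: "finite K" "finite X" "finite C"
    and card_K: "card K > 1"
    and coord: "x \<in> X \<Longrightarrow> i < n \<Longrightarrow> x i \<in> K"
    and update: "x \<in> X \<Longrightarrow> i < n \<Longrightarrow> b \<in> K \<Longrightarrow> x(i := b) \<in> X"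
    and ip_closed: "c \<in> C \<Longrightarrow> x \<in> X \<Longrightarrow> ip c x \<in> K"
    and ip_balanced: "x \<in> X \<Longrightarrow> y \<in> X \<Longrightarrow> c \<in> C \<Longrightarrow> ip c x \<noteq> ip c y \<Longrightarrow>
      card {c \<in> C. ip c x = ip c y} * card K = card C"
    and ip_update_nz: "c \<in> C \<Longrightarrow> x \<in> X \<Longrightarrow> i < n \<Longrightarrow> nz c i \<Longrightarrow> v \<in> K \<Longrightarrow>
      card {b \<in> K. ip c (x(i := b)) = v} = 1"
    and ip_update_z: "c \<in> C \<Longrightarrow> x \<in> X \<Longrightarrow> i < n \<Longrightarrow> \<not> nz c i \<Longrightarrow> b \<in> K \<Longrightarrow>
      ip c (x(i := b)) = ip c x"
    and o: "o' \<in> C" "x \<in> X \<Longrightarrow> y \<in> X \<Longrightarrow> ip o' x = ip o' y"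
    and weight: "c \<in> C \<Longrightarrow> c \<noteq> o' \<Longrightarrow> d \<le> card {i \<in> {..<n}. nz c i}"
begin

abbreviation q :: real where "q \<equiv> real (card K)"

text \<open>Congruence modulo the dual code. The quotient graph is never built: sums over its
  vertices become double sums over words weighted by \<open>equiv\<close>.\<close>

definition equiv :: "(nat \<Rightarrow> 'a) \<Rightarrow> (nat \<Rightarrow> 'a) \<Rightarrow> bool" where
  "equiv x y \<longleftrightarrow> (\<forall>c\<in>C. ip c x = ip c y)"

lemma q_gt_1: "q > 1" using card_K by simp

text \<open>Takes the place of orthogonality of characters: the codewords that fail to separate
  \<open>x\<close> from \<open>y\<close> are either all of \<open>C\<close> or, by
  \<open>ip_balanced\<close>, the fraction \<open>1/q\<close> of it.\<close>

lemma sum_ip_eq: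
  assumes "x \<in> X" "y \<in> X"
  shows "(\<Sum>c\<in>C. of_bool (ip c x = ip c y)) = card C / q * (1 + (q - 1) * of_bool (equiv x y))"
proof -
  have eq: "(\<Sum>c\<in>C. of_bool (ip c x = ip c y)) = real (card {c \<in> C. ip c x = ip c y})"
    using finite by (simp add: sum_of_bool_eq Int_def)
  show ?thesis
  proof (cases "equiv x y")
    case True
    then have "{c \<in> C. ip c x = ip c y} = C" by (auto simp: equiv_def)
    then show ?thesis using True eq q_gt_1 by simp
  next
    case False
    then obtain c where "c \<in> C" "ip c x \<noteq> ip c y" by (auto simp: equiv_def)
    then have "real (card {c \<in> C. ip c x = ip c y}) * q = card C"
      using ip_balanced[OF assms] by (metis of_nat_mult)
    then show ?thesis using False eq q_gt_1 by (simp add: field_simps)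
  qed
qed

text \<open>Adjacency of the quotient graph in direction \<open>i\<close>. The value
  \<open>b = x i\<close> is allowed, so each direction adds a loop and all \<open>n\<close>
  directions together shift the eigenvalues by \<open>n\<close>.\<close>

definition hits :: "nat \<Rightarrow> (nat \<Rightarrow> 'a) \<Rightarrow> (nat \<Rightarrow> 'a) \<Rightarrow> real" where
  "hits i x y = (\<Sum>b\<in>K. of_bool (equiv (x(i := b)) y))"

text \<open>Double counting of the pairs \<open>(b, c)\<close> with
  \<open>ip c (x(i := b)) = ip c y\<close>: a codeword nonzero at \<open>i\<close> is matched by
  exactly one \<open>b\<close>, any other by all \<open>b\<close> or none. The equation is then
  solved for the part with \<open>nz c i\<close>.\<close>

lemma sum_ip_eq_nz:
  assumes x: "x \<in> X" and y: "y \<in> X" and i: "i < n"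
  shows "(\<Sum>c\<in>C. of_bool (nz c i) * of_bool (ip c x = ip c y)) =
    card C / q * (1 + (q - 1) * of_bool (equiv x y)) + (\<Sum>c\<in>C. of_bool (nz c i)) / q
    - card C / q\<^sup>2 * (q + (q - 1) * hits i x y)"
proof -
  have "card C / q * (q + (q - 1) * hits i x y) =
    (\<Sum>b\<in>K. card C / q * (1 + (q - 1) * of_bool (equiv (x(i := b)) y)))"
    by (subst sum_distrib_left[symmetric, where r = "card C / q"])
      (simp add: hits_def sum.distrib sum_distrib_left)
  also have "\<dots> = (\<Sum>b\<in>K. \<Sum>c\<in>C. of_bool (ip c (x(i := b)) = ip c y))"
    using update[OF x i] y by (intro sum.cong refl sum_ip_eq[symmetric]) auto
  also have "\<dots> = (\<Sum>c\<in>C. \<Sum>b\<in>K. of_bool (ip c (x(i := b)) = ip c y))"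
    by (rule sum.swap)
  also have "\<dots> = (\<Sum>c\<in>C. of_bool (nz c i)
      + q * (of_bool (ip c x = ip c y) - of_bool (nz c i) * of_bool (ip c x = ip c y)))"
  proof (intro sum.cong refl)
    fix c assume c: "c \<in> C"
    show "(\<Sum>b\<in>K. of_bool (ip c (x(i := b)) = ip c y)) = of_bool (nz c i)
      + q * (of_bool (ip c x = ip c y) - of_bool (nz c i) * of_bool (ip c x = ip c y))"
    proof (cases "nz c i")
      case True
      have "(\<Sum>b\<in>K. of_bool (ip c (x(i := b)) = ip c y)) = real (card {b \<in> K. ip c (x(i := b)) = ip c y})"
        using finite by (simp add: sum_of_bool_eq Int_def)
      then show ?thesis using ip_update_nz[OF c x i True ip_closed[OF c y]] True by simp
    next
      case False
      have "(\<Sum>b\<in>K. of_bool (ip c (x(i := b)) = ip c y)) = (\<Sum>b\<in>K. (of_bool (ip c x = ip c y) :: real))"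
        using ip_update_z[OF c x i False] by (intro sum.cong) auto
      then show ?thesis using False by simp
    qed
  qed
  also have "\<dots> = (\<Sum>c\<in>C. of_bool (nz c i)) + q * ((\<Sum>c\<in>C. of_bool (ip c x = ip c y))
      - (\<Sum>c\<in>C. of_bool (nz c i) * of_bool (ip c x = ip c y)))"
    by (simp only: sum.distrib sum_subtractf sum_distrib_left[symmetric])
  finally have eq: "card C / q * (q + (q - 1) * hits i x y) = (\<Sum>c\<in>C. of_bool (nz c i)) +
    q * (card C / q * (1 + (q - 1) * of_bool (equiv x y))
      - (\<Sum>c\<in>C. of_bool (nz c i) * of_bool (ip c x = ip c y)))"
    unfolding sum_ip_eq[OF x y] .
  have solve: "V = Z + W / q - Y / q" if "Y = W + q * (Z - V)" for V W Y Z
    unfolding that using q_gt_1 by (simp add: add_divide_distrib)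
  show ?thesis using solve[OF eq] by (simp add: power2_eq_square)
qed

text \<open>\<open>Q c\<close> plays the role of the Fourier mass of \<open>f\<close> on the
  nontrivial characters of the functional \<open>ip c\<close>, and \<open>M\<close> is the squared
  norm of the push-forward. The first two identities are Parseval's, for the identity operator and
  for the adjacency in direction \<open>i\<close>; summing the latter over \<open>i\<close>
  multiplies \<open>Q c\<close> by the weight of \<open>c\<close>.\<close>

lemma linear_programming_identities:
  fixes f :: "(nat \<Rightarrow> 'a) \<Rightarrow> real"
  assumes S_def: "S = (\<Sum>x\<in>X. f x)"
    and M_def: "M = (\<Sum>x\<in>X. \<Sum>y\<in>X. f x * f y * of_bool (equiv x y))"
    and Q_def: "\<And>c. Q c = (\<Sum>x\<in>X. \<Sum>y\<in>X. f x * f y * of_bool (ip c x = ip c y)) - S\<^sup>2 / q"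
  shows "(\<Sum>c\<in>C. Q c) = card C * (q - 1) / q * M" (is ?A)
    and "\<And>i. i < n \<Longrightarrow> (\<Sum>c\<in>C. of_bool (nz c i) * Q c) = card C * (q - 1) / q\<^sup>2 *
      (q * M - (\<Sum>x\<in>X. \<Sum>y\<in>X. f x * f y * hits i x y))" (is "\<And>i. i < n \<Longrightarrow> ?B i")
    and "\<And>c. c \<in> C \<Longrightarrow> 0 \<le> Q c"
    and "Q o' = S\<^sup>2 * (q - 1) / q"
proof -
  have S2: "(\<Sum>x\<in>X. \<Sum>y\<in>X. f x * f y) = S\<^sup>2"
    unfolding S_def power2_eq_square by (simp add: sum_product)
  have swap: "(\<Sum>c\<in>C. w c * (\<Sum>x\<in>X. \<Sum>y\<in>X. f x * f y * of_bool (ip c x = ip c y))) =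
    (\<Sum>x\<in>X. \<Sum>y\<in>X. f x * f y * (\<Sum>c\<in>C. w c * of_bool (ip c x = ip c y)))" for w :: "'c \<Rightarrow> real"
  proof -
    have "(\<Sum>c\<in>C. w c * (\<Sum>x\<in>X. \<Sum>y\<in>X. f x * f y * of_bool (ip c x = ip c y))) =
      (\<Sum>c\<in>C. \<Sum>x\<in>X. \<Sum>y\<in>X. f x * f y * (w c * of_bool (ip c x = ip c y)))"
      by (simp add: sum_distrib_left mult_ac)
    also have "\<dots> = (\<Sum>x\<in>X. \<Sum>c\<in>C. \<Sum>y\<in>X. f x * f y * (w c * of_bool (ip c x = ip c y)))"
      by (rule sum.swap)
    also have "\<dots> = (\<Sum>x\<in>X. \<Sum>y\<in>X. \<Sum>c\<in>C. f x * f y * (w c * of_bool (ip c x = ip c y)))"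
      by (intro sum.cong refl sum.swap)
    finally show ?thesis by (simp add: sum_distrib_left)
  qed
  have lin: "(\<Sum>x\<in>X. \<Sum>y\<in>X. f x * f y * (a + b * g x y)) =
      a * S\<^sup>2 + b * (\<Sum>x\<in>X. \<Sum>y\<in>X. f x * f y * g x y)" for a b g
    unfolding S2[symmetric] by (simp add: sum_distrib_left sum.distrib algebra_simps)
  have lin2: "(\<Sum>x\<in>X. \<Sum>y\<in>X. f x * f y * (a * g x y - b * h x y)) =
      a * (\<Sum>x\<in>X. \<Sum>y\<in>X. f x * f y * g x y) - b * (\<Sum>x\<in>X. \<Sum>y\<in>X. f x * f y * h x y)" for a b g h
    by (simp add: sum_distrib_left sum_subtractf algebra_simps)
  have "(\<Sum>c\<in>C. Q c) = (\<Sum>c\<in>C. 1 * (\<Sum>x\<in>X. \<Sum>y\<in>X. f x * f y * of_bool (ip c x = ip c y))) - card C * S\<^sup>2 / q"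
    unfolding Q_def by (simp add: sum_subtractf)
  also have "\<dots> = (\<Sum>x\<in>X. \<Sum>y\<in>X. f x * f y * (card C / q + card C / q * (q - 1) * of_bool (equiv x y))) - card C * S\<^sup>2 / q"
    unfolding swap
    by (intro arg_cong2[where f = "(-)"] refl sum.cong arg_cong2[where f = "(*)"])
      (simp only: mult_1_left sum_ip_eq distrib_left mult_1_right mult.assoc)
  also have "\<dots> = card C * (q - 1) / q * M"
    unfolding lin M_def by simp
  finally show ?A .
  show "?B i" if i: "i < n" for i
  proof -
    let ?w = "\<Sum>c\<in>C. of_bool (nz c i) :: real"
    have "(\<Sum>c\<in>C. of_bool (nz c i) * Q c) =
      (\<Sum>c\<in>C. of_bool (nz c i) * (\<Sum>x\<in>X. \<Sum>y\<in>X. f x * f y * of_bool (ip c x = ip c y))) - ?w * S\<^sup>2 / q"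
      unfolding Q_def by (simp add: right_diff_distrib sum_subtractf sum_distrib_right sum_divide_distrib)
    also have "\<dots> = (\<Sum>x\<in>X. \<Sum>y\<in>X. f x * f y * (?w / q + 1 *
        (card C / q * (q - 1) * of_bool (equiv x y) - card C / q\<^sup>2 * (q - 1) * hits i x y))) - ?w * S\<^sup>2 / q"
      unfolding swap using q_gt_1
      by (intro arg_cong2[where f = "(-)"] refl sum.cong arg_cong2[where f = "(*)"])
        (simp add: sum_ip_eq_nz[OF _ _ i] field_simps power2_eq_square)
    also have "\<dots> = (\<Sum>x\<in>X. \<Sum>y\<in>X. f x * f y * (card C / q * (q - 1) * of_bool (equiv x y) - card C / q\<^sup>2 * (q - 1) * hits i x y))"
      unfolding lin by simp
    also have "\<dots> = card C / q * (q - 1) * M - card C / q\<^sup>2 * (q - 1) * (\<Sum>x\<in>X. \<Sum>y\<in>X. f x * f y * hits i x y)"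
      unfolding M_def by (rule lin2)
    also have "\<dots> = card C * (q - 1) / q\<^sup>2 * (q * M - (\<Sum>x\<in>X. \<Sum>y\<in>X. f x * f y * hits i x y))"
      using q_gt_1 by (simp add: field_simps power2_eq_square)
    finally show ?thesis .
  qed
  \<comment> \<open>Cauchy-Schwarz over the \<open>q\<close> level sums, whose total is
    \<open>S\<close>.\<close>
  show "0 \<le> Q c" if c: "c \<in> C" for c
  proof -
    let ?F = "\<lambda>t. \<Sum>x\<in>X. f x * of_bool (ip c x = t)"
    have "(\<Sum>t\<in>K. ?F t) = (\<Sum>x\<in>X. \<Sum>t\<in>K. f x * of_bool (ip c x = t))" by (rule sum.swap)
    also have "\<dots> = (\<Sum>x\<in>X. \<Sum>t\<in>K. if ip c x = t then f x else 0)"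
      by (intro sum.cong) auto
    also have "\<dots> = S"
      unfolding S_def using ip_closed[OF c] finite by (intro sum.cong refl) (simp add: sum.delta')
    finally have "S\<^sup>2 \<le> q * (\<Sum>t\<in>K. (?F t)\<^sup>2)" using sum_square_le_card[OF finite(1), of ?F] by simp
    moreover have "(\<Sum>x\<in>X. \<Sum>y\<in>X. f x * f y * of_bool (ip c x = ip c y)) = (\<Sum>t\<in>K. (?F t)\<^sup>2)"
      using finite ip_closed[OF c] by (intro sum_collisions) auto
    ultimately show ?thesis unfolding Q_def using q_gt_1 by (simp add: field_simps)
  qed
  have "(\<Sum>x\<in>X. \<Sum>y\<in>X. f x * f y * of_bool (ip o' x = ip o' y)) = S\<^sup>2"
    unfolding S2[symmetric]
  proof (intro sum.cong refl)
    fix x y assume "x \<in> X" "y \<in> X"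
    then show "f x * f y * of_bool (ip o' x = ip o' y) = f x * f y" using o(2)[of x y] by simp
  qed
  then show "Q o' = S\<^sup>2 * (q - 1) / q"
    unfolding Q_def using q_gt_1 by (simp add: field_simps)
qed

text \<open>Moving the adjacency from the relation onto \<open>f\<close> uses the involution that
  sends \<open>(x, b)\<close> to \<open>(x(i := b), x i)\<close>.\<close>

lemma sum_hits:
  fixes f :: "(nat \<Rightarrow> 'a) \<Rightarrow> real"
  assumes i: "i < n"
  shows "(\<Sum>x\<in>X. \<Sum>y\<in>X. f x * f y * hits i x y) =
    (\<Sum>x\<in>X. \<Sum>y\<in>X. f y * (\<Sum>b\<in>K. f (x(i := b))) * of_bool (equiv x y))"
proof -
  let ?g = "\<lambda>(x, b). (x(i := b), x i)"
  have g: "?g p \<in> X \<times> K" "?g (?g p) = p" if "p \<in> X \<times> K" for p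
    using that update[OF _ i] coord[OF _ i] by auto
  have "(\<Sum>x\<in>X. f x * hits i x y) = (\<Sum>x\<in>X. (\<Sum>b\<in>K. f (x(i := b))) * of_bool (equiv x y))" for y
  proof -
    have "(\<Sum>x\<in>X. f x * hits i x y) = (\<Sum>(x, b)\<in>X \<times> K. f x * of_bool (equiv (x(i := b)) y))"
      by (simp add: hits_def sum_distrib_left sum.cartesian_product)
    also have "\<dots> = (\<Sum>(x, b)\<in>X \<times> K. f (x(i := b)) * of_bool (equiv x y))"
      by (rule sum.reindex_bij_witness[of _ ?g ?g]) (use g in \<open>auto simp del: fun_upd_apply\<close>)
    finally show ?thesis by (simp add: sum_distrib_right sum.cartesian_product)
  qed
  then have "(\<Sum>y\<in>X. f y * (\<Sum>x\<in>X. f x * hits i x y)) =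
    (\<Sum>y\<in>X. f y * (\<Sum>x\<in>X. (\<Sum>b\<in>K. f (x(i := b))) * of_bool (equiv x y)))" by simp
  then have "(\<Sum>y\<in>X. \<Sum>x\<in>X. f x * f y * hits i x y) =
    (\<Sum>y\<in>X. \<Sum>x\<in>X. f y * (\<Sum>b\<in>K. f (x(i := b))) * of_bool (equiv x y))"
    by (simp add: sum_distrib_left mult_ac)
  then show ?thesis by (subst (1 2) sum.swap)
qed

text \<open>A codeword of weight \<open>w\<close> belongs to the eigenvalue
  \<open>(q - 1) n - q w\<close>, so by \<open>l\<close> all nontrivial eigenvalues are at most
  \<open>l - 1\<close>. By \<open>eig\<close> the Rayleigh quotient of the push-forward is at least
  \<open>l\<close>; this gap of 1 leaves the trivial character at least the fraction
  \<open>1/(q d)\<close> of the mass, that is \<open>card C * M \<le> q d S\<^sup>2\<close>.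
  Cauchy-Schwarz over the at most \<open>card B\<close> classes met by \<open>B\<close> gives
  \<open>S\<^sup>2 \<le> card B * M\<close>.\<close>

lemma linear_programming_bound:
  fixes f :: "(nat \<Rightarrow> 'a) \<Rightarrow> real" and l :: real
  assumes f0: "\<And>x. x \<in> X \<Longrightarrow> 0 \<le> f x" and B: "B \<subseteq> X" "\<And>x. x \<in> X \<Longrightarrow> x \<notin> B \<Longrightarrow> f x = 0"
    and z: "z \<in> X" "0 < f z"
    and eig: "\<And>x. x \<in> X \<Longrightarrow> (l + n) * f x \<le> (\<Sum>i<n. \<Sum>b\<in>K. f (x(i := b)))"
    and l: "(q - 1) * n - q * d + 1 \<le> l"
  shows "card C \<le> q * d * card B"
proof -
  define S where "S = (\<Sum>x\<in>X. f x)"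
  define M where "M = (\<Sum>x\<in>X. \<Sum>y\<in>X. f x * f y * of_bool (equiv x y))"
  define Q where "Q c = (\<Sum>x\<in>X. \<Sum>y\<in>X. f x * f y * of_bool (ip c x = ip c y)) - S\<^sup>2 / q" for c
  define A where "A i = (\<Sum>x\<in>X. \<Sum>y\<in>X. f x * f y * hits i x y)" for i
  note ids = linear_programming_identities[OF S_def M_def Q_def, folded A_def]
  have "(l + n) * M = (\<Sum>x\<in>X. \<Sum>y\<in>X. f y * ((l + n) * f x) * of_bool (equiv x y))"
    unfolding M_def by (simp add: sum_distrib_left mult_ac)
  also have "\<dots> \<le> (\<Sum>x\<in>X. \<Sum>y\<in>X. f y * (\<Sum>i<n. \<Sum>b\<in>K. f (x(i := b))) * of_bool (equiv x y))"
    by (intro sum_mono mult_right_mono mult_left_mono eig f0) auto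
  also have "\<dots> = (\<Sum>x\<in>X. \<Sum>y\<in>X. \<Sum>i<n. f y * (\<Sum>b\<in>K. f (x(i := b))) * of_bool (equiv x y))"
    by (simp only: sum_distrib_left sum_distrib_right)
  also have "\<dots> = (\<Sum>x\<in>X. \<Sum>i<n. \<Sum>y\<in>X. f y * (\<Sum>b\<in>K. f (x(i := b))) * of_bool (equiv x y))"
    by (intro sum.cong refl sum.swap)
  also have "\<dots> = (\<Sum>i<n. \<Sum>x\<in>X. \<Sum>y\<in>X. f y * (\<Sum>b\<in>K. f (x(i := b))) * of_bool (equiv x y))"
    by (rule sum.swap)
  also have "\<dots> = (\<Sum>i<n. A i)" unfolding A_def by (intro sum.cong refl sum_hits[symmetric]) simp
  finally have lower: "(l + n) * M \<le> (\<Sum>i<n. A i)" .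
  \<comment> \<open>The minimum distance enters here, as a lower bound for the factor that the
    weight of \<open>c\<close> puts on \<open>Q c\<close>.\<close>
  have "d * (\<Sum>c\<in>C - {o'}. Q c) \<le> (\<Sum>c\<in>C - {o'}. (\<Sum>i<n. of_bool (nz c i)) * Q c)"
    unfolding sum_distrib_left
  proof (intro sum_mono mult_right_mono)
    fix c assume "c \<in> C - {o'}"
    then show "real d \<le> (\<Sum>i<n. of_bool (nz c i))" "0 \<le> Q c"
      using weight[of c] ids(3) by (simp_all add: sum_of_bool_eq Int_def)
  qed
  also have "\<dots> \<le> (\<Sum>c\<in>C. (\<Sum>i<n. of_bool (nz c i)) * Q c)"
    using finite ids(3) by (intro sum_mono2) (auto intro!: mult_nonneg_nonneg sum_nonneg)
  also have "\<dots> = (\<Sum>i<n. \<Sum>c\<in>C. of_bool (nz c i) * Q c)"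
    unfolding sum_distrib_right by (rule sum.swap)
  also have "\<dots> = (\<Sum>i<n. card C * (q - 1) / q\<^sup>2 * (q * M - A i))"
    using ids(2) by simp
  also have "\<dots> = card C * (q - 1) / q\<^sup>2 * (n * q * M - (\<Sum>i<n. A i))"
    by (subst sum_distrib_left[symmetric, where r = "card C * (q - 1) / q\<^sup>2"])
      (simp add: sum_subtractf mult.assoc)
  finally have "d * (\<Sum>c\<in>C - {o'}. Q c) \<le> card C * (q - 1) / q\<^sup>2 * (n * q * M - (\<Sum>i<n. A i))" .
  moreover have "(\<Sum>c\<in>C - {o'}. Q c) = card C * (q - 1) / q * M - S\<^sup>2 * (q - 1) / q"
    using ids(1,4) finite o(1) by (simp add: sum_diff1)
  ultimately have "d * (card C * (q - 1) / q * M - S\<^sup>2 * (q - 1) / q) \<le>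
    card C * (q - 1) / q\<^sup>2 * (n * q * M - (l + n) * M)"
    using lower q_gt_1 by (smt (verit, best) divide_nonneg_nonneg mult_left_mono mult_nonneg_nonneg of_nat_0_le_iff zero_le_power2)
  also have "\<dots> \<le> card C * (q - 1) / q\<^sup>2 * ((q * d - 1) * M)"
  proof -
    have "0 \<le> M" unfolding M_def using f0 by (intro sum_nonneg) auto
    then have "(n * q - (l + n)) * M \<le> (q * d - 1) * M"
      using l by (intro mult_right_mono) (simp_all add: algebra_simps)
    then have "n * q * M - (l + n) * M \<le> (q * d - 1) * M" by (simp add: algebra_simps)
    moreover have "0 \<le> card C * (q - 1) / q\<^sup>2" using q_gt_1 by simp
    ultimately show ?thesis by (rule mult_left_mono)
  qed
  finally have "q\<^sup>2 * (d * (card C * (q - 1) / q * M - S\<^sup>2 * (q - 1) / q)) \<le>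
    q\<^sup>2 * (card C * (q - 1) / q\<^sup>2 * ((q * d - 1) * M))" by (rule mult_left_mono) simp
  moreover have "q\<^sup>2 * (d * (card C * (q - 1) / q * M - S\<^sup>2 * (q - 1) / q)) =
      (q - 1) * (q * d * (card C * M - S\<^sup>2))"
    using q_gt_1 by (simp add: field_simps power2_eq_square)
  moreover have "q\<^sup>2 * (card C * (q - 1) / q\<^sup>2 * ((q * d - 1) * M)) = (q - 1) * (card C * ((q * d - 1) * M))"
    using q_gt_1 by simp
  ultimately have "(q - 1) * (q * d * (card C * M - S\<^sup>2)) \<le> (q - 1) * (card C * ((q * d - 1) * M))"
    by (simp only:)
  then have "q * d * (card C * M - S\<^sup>2) \<le> card C * ((q * d - 1) * M)"
    using q_gt_1 by simp
  then have MS: "card C * M \<le> q * d * S\<^sup>2" by (simp add: algebra_simps)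
  have fB: "finite B" using B finite finite_subset by blast
  \<comment> \<open>The tuple of all values \<open>ip c x\<close> names the class of
    \<open>x\<close> modulo the dual code.\<close>
  let ?h = "\<lambda>x. \<lambda>c\<in>C. ip c x"
  let ?F = "\<lambda>t. \<Sum>x\<in>B. f x * of_bool (?h x = t)"
  have h: "(?h x = ?h y) = equiv x y" for x y
    by (auto simp: equiv_def restrict_def fun_eq_iff)
  have SB: "S = (\<Sum>x\<in>B. f x)"
    unfolding S_def using B finite by (intro sum.mono_neutral_right) auto
  have "M = (\<Sum>x\<in>X. \<Sum>y\<in>B. f x * f y * of_bool (equiv x y))"
    unfolding M_def using B finite by (intro sum.cong refl sum.mono_neutral_right) auto
  also have "\<dots> = (\<Sum>x\<in>B. \<Sum>y\<in>B. f x * f y * of_bool (equiv x y))"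
    using B finite by (intro sum.mono_neutral_right) auto
  also have "\<dots> = (\<Sum>x\<in>B. \<Sum>y\<in>B. f x * f y * of_bool (?h x = ?h y))" by (simp only: h)
  also have "\<dots> = (\<Sum>t\<in>?h ` B. (?F t)\<^sup>2)"
    using fB by (intro sum_collisions) auto
  finally have M: "M = (\<Sum>t\<in>?h ` B. (?F t)\<^sup>2)" .
  have "(\<Sum>t\<in>?h ` B. ?F t) = (\<Sum>x\<in>B. \<Sum>t\<in>?h ` B. f x * of_bool (?h x = t))" by (rule sum.swap)
  also have "\<dots> = (\<Sum>x\<in>B. \<Sum>t\<in>?h ` B. if ?h x = t then f x else 0)"
    by (intro sum.cong) auto
  also have "\<dots> = S"
    unfolding SB using fB by (intro sum.cong refl) (simp add: sum.delta')
  finally have "S\<^sup>2 \<le> card (?h ` B) * M"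
    using sum_square_le_card[of "?h ` B" ?F] fB M by simp
  also have "\<dots> \<le> card B * M"
    using fB M by (intro mult_right_mono) (auto intro: card_image_le sum_nonneg)
  finally have SM: "S\<^sup>2 \<le> card B * M" .
  have "0 < S"
    unfolding S_def using finite f0 z by (intro sum_pos2[of _ z]) auto
  then have "0 < card B * M" using SM by (smt (verit) zero_less_power2)
  then have "0 < M" by (simp add: zero_less_mult_iff)
  have "card C * M \<le> q * d * (card B * M)"
    using MS SM q_gt_1 by (smt (verit) mult_left_mono mult_nonneg_nonneg of_nat_0_le_iff)
  then show ?thesis using \<open>0 < M\<close> by simp
qed

end

section \<open>Radial functions on Hamming space\<close>

text \<open>Weight relative to a distinguished letter \<open>z\<close>, so that radial functions
  need no field structure; \<open>z\<close> becomes the zero of the field.\<close>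

definition wt :: "'a \<Rightarrow> nat \<Rightarrow> (nat \<Rightarrow> 'a) \<Rightarrow> nat" where
  "wt z n x = card {i \<in> {..<n}. x i \<noteq> z}"

lemma wt_le: "wt z n x \<le> n"
proof -
  have "card {i \<in> {..<n}. x i \<noteq> z} \<le> card {..<n}" by (intro card_mono) auto
  then show ?thesis by (simp add: wt_def)
qed

lemma wt_update:
  assumes "i < n"
  shows "x i = z \<Longrightarrow> b \<noteq> z \<Longrightarrow> wt z n (x(i := b)) = Suc (wt z n x)"
    and "x i \<noteq> z \<Longrightarrow> b \<noteq> z \<Longrightarrow> wt z n (x(i := b)) = wt z n x"
    and "x i \<noteq> z \<Longrightarrow> wt z n (x(i := z)) = wt z n x - 1"
    and "x i = z \<Longrightarrow> wt z n (x(i := z)) = wt z n x"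
proof -
  let ?S = "{l \<in> {..<n}. x l \<noteq> z}"
  show "wt z n (x(i := b)) = Suc (wt z n x)" if "x i = z" "b \<noteq> z"
  proof -
    have "{l \<in> {..<n}. (x(i := b)) l \<noteq> z} = insert i ?S" using that assms by auto
    moreover have "i \<notin> ?S" using that by simp
    ultimately show ?thesis unfolding wt_def by simp
  qed
  show "wt z n (x(i := b)) = wt z n x" if "x i \<noteq> z" "b \<noteq> z"
  proof -
    have "{l \<in> {..<n}. (x(i := b)) l \<noteq> z} = ?S" using that assms by auto
    then show ?thesis unfolding wt_def by simp
  qed
  show "wt z n (x(i := z)) = wt z n x - 1" if "x i \<noteq> z"
  proof -
    have "{l \<in> {..<n}. (x(i := z)) l \<noteq> z} = ?S - {i}" using assms by auto
    then show ?thesis unfolding wt_def using that assms by simp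
  qed
  show "wt z n (x(i := z)) = wt z n x" if "x i = z" using fun_upd_idem[of x i z] that by simp
qed

text \<open>A coordinate different from \<open>z\<close> has one value lowering the weight and
  \<open>card K - 1\<close> keeping it; a coordinate equal to \<open>z\<close> has one keeping it
  and \<open>card K - 1\<close> raising it. At weight 0 the truncated \<open>wt z n x - 1\<close> is
  harmless, since its factor is 0.\<close>

lemma sum_radial_update:
  fixes g :: "nat \<Rightarrow> real"
  assumes K: "finite K" "z \<in> K"
  shows "(\<Sum>i<n. \<Sum>b\<in>K. g (wt z n (x(i := b)))) =
    wt z n x * (g (wt z n x - 1) + (real (card K) - 1) * g (wt z n x)) +
    (real n - wt z n x) * (g (wt z n x) + (real (card K) - 1) * g (Suc (wt z n x)))"
proof -
  let ?w = "wt z n x"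
  let ?S = "{i \<in> {..<n}. x i \<noteq> z}"
  let ?nz = "g (?w - 1) + (real (card K) - 1) * g ?w"
  let ?z = "g ?w + (real (card K) - 1) * g (Suc ?w)"
  have c: "real (card (K - {z})) = real (card K) - 1"
    using K card_Suc_Diff1[OF K] by (simp add: of_nat_diff)
  have "(\<Sum>b\<in>K. g (wt z n (x(i := b)))) = (if x i \<noteq> z then ?nz else ?z)" if i: "i < n" for i
  proof -
    have "(\<Sum>b\<in>K. g (wt z n (x(i := b)))) = g (wt z n (x(i := z))) + (\<Sum>b\<in>K - {z}. g (wt z n (x(i := b))))"
      using K by (simp add: sum.remove)
    also have "(\<Sum>b\<in>K - {z}. g (wt z n (x(i := b)))) =
      (\<Sum>b\<in>K - {z}. if x i \<noteq> z then g ?w else g (Suc ?w))"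
    proof (intro sum.cong refl)
      fix b assume "b \<in> K - {z}"
      then show "g (wt z n (x(i := b))) = (if x i \<noteq> z then g ?w else g (Suc ?w))"
        using wt_update(1)[OF i, of x z b] wt_update(2)[OF i, of x z b] by auto
    qed
    also have "\<dots> = (real (card K) - 1) * (if x i \<noteq> z then g ?w else g (Suc ?w))"
      by (simp only: sum_constant c)
    also have "g (wt z n (x(i := z))) = (if x i \<noteq> z then g (?w - 1) else g ?w)"
      using wt_update(3,4)[OF i, of x z] by auto
    finally show ?thesis by (cases "x i \<noteq> z") (simp_all only: if_True if_False not_False_eq_True simp_thms)
  qed
  then have "(\<Sum>i<n. \<Sum>b\<in>K. g (wt z n (x(i := b)))) = (\<Sum>i<n. if x i \<noteq> z then ?nz else ?z)"
    by (intro sum.cong) auto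
  also have "\<dots> = (\<Sum>i\<in>{..<n} \<inter> {i. x i \<noteq> z}. ?nz) + (\<Sum>i\<in>{..<n} \<inter> - {i. x i \<noteq> z}. ?z)"
    by (intro sum.If_cases) simp
  also have "{..<n} \<inter> {i. x i \<noteq> z} = ?S" by auto
  also have "{..<n} \<inter> - {i. x i \<noteq> z} = {..<n} - ?S" by auto
  also have "(\<Sum>i\<in>{..<n} - ?S. ?z) = (real n - ?w) * ?z"
  proof -
    have "card ({..<n} - ?S) = n - ?w" by (subst card_Diff_subset) (auto simp: wt_def)
    then show ?thesis by (simp only: sum_constant of_nat_diff[OF wt_le])
  qed
  finally show ?thesis by (simp add: wt_def)
qed

text \<open>Chernoff's argument: on the ball \<open>y ^ wt z n x\<close> is at least
  \<open>y ^ r\<close>, and its sum over all words factors over the coordinates.\<close>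

lemma card_ball_le:
  fixes y :: real
  assumes K: "finite K" "z \<in> K" and y: "0 < y" "y \<le> 1"
  shows "real (card {x \<in> {..<n} \<rightarrow>\<^sub>E K. wt z n x \<le> r}) \<le> (1 + (real (card K) - 1) * y) ^ n / y ^ r"
proof -
  let ?X = "{..<n} \<rightarrow>\<^sub>E K"
  have finX: "finite ?X" using K by (intro finite_PiE) auto
  have pw: "y ^ wt z n x = (\<Prod>i<n. if x i \<noteq> z then y else 1)" for x
  proof -
    have "(\<Prod>i<n. if x i \<noteq> z then y else 1) = (\<Prod>i\<in>{i\<in>{..<n}. x i \<noteq> z}. y)"
      by (rule prod.inter_filter[symmetric]) simp
    then show ?thesis by (simp add: wt_def)
  qed
  have "real (card {x \<in> ?X. wt z n x \<le> r}) * y ^ r = (\<Sum>x\<in>{x \<in> ?X. wt z n x \<le> r}. y ^ r)" by simp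
  also have "\<dots> \<le> (\<Sum>x\<in>{x \<in> ?X. wt z n x \<le> r}. y ^ wt z n x)"
    using y by (intro sum_mono power_decreasing) auto
  also have "\<dots> \<le> (\<Sum>x\<in>?X. y ^ wt z n x)"
    using y finX by (intro sum_mono2) auto
  also have "\<dots> = (\<Prod>i<n. \<Sum>b\<in>K. if b \<noteq> z then y else 1)"
    unfolding pw using K by (intro prod_sum_PiE[symmetric]) auto
  also have "(\<Sum>b\<in>K. if b \<noteq> z then y else 1) = 1 + (real (card K) - 1) * y"
  proof -
    have "(\<Sum>b\<in>K. if b \<noteq> z then y else 1) = 1 + (\<Sum>b\<in>K - {z}. y)"
      using K by (simp add: sum.remove)
    moreover have "real (card (K - {z})) = real (card K) - 1"
      using K card_Suc_Diff1[OF K] by (simp add: of_nat_diff)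
    ultimately show ?thesis by simp
  qed
  finally show ?thesis using y by (simp add: field_simps)
qed

text \<open>The first eigenvector of a path with \<open>m\<close> vertices, placed on the weights
  \<open>r - m < w \<le> r\<close> and rescaled geometrically to symmetrise the transition between weights.\<close>

lemma radial_eigenfunction:
  fixes q :: real and n r m :: nat
  assumes q: "q \<ge> 2" and m: "1 \<le> m" "m < r" and r: "r < n"
  defines "l \<equiv> (real r - m) * (q - 2) +
      2 * (1 - m / r) * sqrt ((q - 1) * r * (real n - r)) * cos (pi / (real m + 1))"
  obtains g :: "nat \<Rightarrow> real" where "\<And>w. 0 \<le> g w" "\<And>w. r < w \<Longrightarrow> g w = 0" "0 < g r"
    "\<And>w. w \<le> n \<Longrightarrow> l * g w \<le> w * g (w - 1) + w * (q - 2) * g w + (real n - w) * (q - 1) * g (Suc w)"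
proof -
  define th where "th = pi / (real m + 1)"
  define P where "P = sqrt ((q - 1) * r * (real n - r))"
  \<comment> \<open>For \<open>g w = t ^ w * s\<close> a step down has coefficient
    \<open>w / t\<close> and a step up \<open>(n - w) (q - 1) t\<close>; this \<open>t\<close> makes
    both equal to \<open>P\<close> at \<open>w = r\<close>.\<close>
  define t where "t = P / ((real n - r) * (q - 1))"
  define s where "s j = sin (th * real j)" for j :: nat
  define g where "g w = (if r - m < w \<and> w \<le> r then t ^ w * s (w - (r - m)) else 0)" for w
  have nr: "0 < real n - r" and rpos: "0 < real r" using m r by auto
  have P: "0 < P" "P * P = (q - 1) * r * (real n - r)" using q nr rpos by (simp_all add: P_def)
  have t: "0 < t" using P q nr by (simp add: t_def)
  have tP: "t * P = r"
  proof -
    have "t * P = (P * P) / ((real n - r) * (q - 1))" by (simp add: t_def)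
    also have "P * P = r * ((real n - r) * (q - 1))" unfolding P(2) by simp
    also have "\<dots> / ((real n - r) * (q - 1)) = r" using q nr by simp
    finally show ?thesis .
  qed
  have tq: "(real n - r) * (q - 1) * t = P" using q nr by (simp add: t_def)
  have th: "0 < th" "th * (real m + 1) = pi" by (simp_all add: th_def add_pos_nonneg)
  have s_nn: "0 \<le> s j" if "j \<le> m + 1" for j
  proof -
    have "th * real j \<le> th * (real m + 1)" using that th by (intro mult_left_mono) auto
    then show ?thesis unfolding s_def using th by (intro sin_ge_zero) auto
  qed
  have s_end: "s 0 = 0" "s (m + 1) = 0" using th(2) by (simp_all add: s_def add.commute)
  have s_pos: "0 < s m"
  proof -
    have "th * real m < pi" using th by (simp add: distrib_left)
    then show ?thesis unfolding s_def using th m by (intro sin_gt_zero) auto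
  qed
  have s_rec: "s (j - 1) + s (j + 1) = 2 * cos th * s j" if "1 \<le> j" for j
  proof -
    have "th * real (j - 1) = th * j - th" "th * real (j + 1) = th * j + th"
      using that by (simp_all add: of_nat_diff algebra_simps)
    then show ?thesis by (simp add: s_def sin_add sin_diff)
  qed
  have cos_nn: "0 \<le> cos th"
  proof -
    have "th * 2 \<le> th * (real m + 1)" using m th by (intro mult_left_mono) auto
    then show ?thesis using th by (intro cos_ge_zero) auto
  qed
  \<comment> \<open>The closed form extends to the weights \<open>r - m\<close> and
    \<open>r + 1\<close>, where the sine vanishes, so the recurrence needs no boundary
    cases.\<close>
  have g_in: "g w = t ^ w * s (w - (r - m))" if "r - m \<le> w" "w \<le> r + 1" for w
  proof -
    consider "w = r - m" | "w = r + 1" | "r - m < w \<and> w \<le> r" using \<open>r - m \<le> w\<close> \<open>w \<le> r + 1\<close> by linarith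
    then show ?thesis
    proof cases
      case 2
      then have "w - (r - m) = m + 1" using m by simp
      then show ?thesis using 2 s_end(2) by (simp add: g_def)
    qed (auto simp: g_def s_end)
  qed
  have g_nn: "0 \<le> g w" for w
    unfolding g_def using t m by (auto intro!: mult_nonneg_nonneg s_nn)
  show ?thesis
  proof (rule that[OF g_nn])
    show "g w = 0" if "r < w" for w using that by (simp add: g_def)
    show "0 < g r" using s_pos t m by (simp add: g_def)
    fix w assume w: "w \<le> n"
    show "l * g w \<le> w * g (w - 1) + w * (q - 2) * g w + (real n - w) * (q - 1) * g (Suc w)"
    proof (cases "r - m < w \<and> w \<le> r")
      case False
      then have "g w = 0" by (simp only: g_def if_False)
      then show ?thesis using g_nn w q by simp
    next
      case True
      define j where "j = w - (r - m)"
      have j: "1 \<le> j" "j \<le> m" using True by (auto simp: j_def)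
      \<comment> \<open>A lower bound for both coefficients on the whole window: the one downwards
        is smallest at the lower end, the one upwards is at least \<open>P\<close>. The loss
        \<open>1 - m / r\<close> tends to 0 in the sense that the factor tends to 1 for fixed
        \<open>m\<close>.\<close>
      define A where "A = (1 - m / r) * P"
      have gw: "g w = t ^ w * s j" "g (w - 1) = t ^ (w - 1) * s (j - 1)" "g (Suc w) = t ^ Suc w * s (j + 1)"
        using g_in[of w] g_in[of "w - 1"] g_in[of "Suc w"] True m by (auto simp: j_def Suc_diff_le)
      have tw: "t ^ w = t ^ (w - 1) * t" using True m by (metis less_nat_zero_code not_gr_zero power_minus_mult)
      have wr: "real r - m \<le> w" using True by linarith
      have At: "A * t = real r - m"
      proof -
        have "A * t = (1 - m / r) * (t * P)" by (simp add: A_def)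
        then show ?thesis using rpos by (simp add: tP left_diff_distrib)
      qed
      have 1: "A * t ^ w * s (j - 1) \<le> w * g (w - 1)"
      proof -
        have "A * t ^ w * s (j - 1) = (real r - m) * (t ^ (w - 1) * s (j - 1))"
          unfolding tw At[symmetric] by simp
        also have "\<dots> \<le> w * (t ^ (w - 1) * s (j - 1))"
          using wr t j by (intro mult_right_mono mult_nonneg_nonneg s_nn) auto
        finally show ?thesis by (simp only: gw)
      qed
      have 2: "A * t ^ w * s (j + 1) \<le> (real n - w) * (q - 1) * g (Suc w)"
      proof -
        have "A \<le> 1 * P" unfolding A_def using P rpos by (intro mult_right_mono) auto
        also have "\<dots> = (real n - r) * (q - 1) * t" by (simp add: tq)
        also have "\<dots> \<le> (real n - w) * (q - 1) * t"
          using True q t by (intro mult_right_mono) auto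
        finally have "A * (t ^ w * s (j + 1)) \<le> (real n - w) * (q - 1) * t * (t ^ w * s (j + 1))"
          using t j by (intro mult_right_mono mult_nonneg_nonneg s_nn) auto
        then show ?thesis by (simp add: gw mult_ac)
      qed
      have 3: "(real r - m) * (q - 2) * g w \<le> w * (q - 2) * g w"
        using wr q g_nn by (intro mult_right_mono) auto
      have "l * g w = (real r - m) * (q - 2) * g w + A * t ^ w * (2 * cos th * s j)"
        by (simp add: l_def A_def P_def th_def gw algebra_simps)
      also have "A * t ^ w * (2 * cos th * s j) = A * t ^ w * s (j - 1) + A * t ^ w * s (j + 1)"
        unfolding s_rec[OF j(1), symmetric] by (simp add: distrib_left)
      finally show ?thesis using 1 2 3 by linarith
    qed
  qed
qed

section \<open>Asymptotics and numerical estimates\<close>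

text \<open>Divided by \<open>n\<close>, with the extremal value \<open>n / (q + E)\<close> in place
  of \<open>k\<close>, the inequalities tend to \<open>H1\<close> and \<open>H2\<close>; strictness
  absorbs the floor and the factor \<open>q n\<close>. The window length \<open>m\<close> is fixed
  first, with the cosine close to 1, so that \<open>m / r\<close> vanishes as \<open>n\<close>
  grows.\<close>

lemma eventually_parameters:
  fixes q :: nat and E rho y :: real
  assumes q: "q \<ge> 2" and E: "E > 0" and rho: "0 < rho" "rho < 1" and y: "0 < y" "y \<le> 1"
    and H1: "(q - 1) * E / (q + E) < (real q - 2) * rho + 2 * sqrt ((real q - 1) * rho * (1 - rho))"
    and H2: "ln (1 + (real q - 1) * y) - rho * ln y < ln q / (q + E)"
  shows "\<exists>m\<ge>1. \<forall>\<^sub>F n in sequentially. m < nat \<lfloor>rho * real n\<rfloor> \<and> nat \<lfloor>rho * real n\<rfloor> < n \<and>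
      (real q - 1) * n - q * ((real q - 1) * (n / (q + E) - 1) + 1) + 1 \<le>
        (real (nat \<lfloor>rho * real n\<rfloor>) - m) * (real q - 2) + 2 * (1 - m / nat \<lfloor>rho * real n\<rfloor>) *
          sqrt ((real q - 1) * nat \<lfloor>rho * real n\<rfloor> * (real n - nat \<lfloor>rho * real n\<rfloor>)) * cos (pi / (real m + 1)) \<and>
      ln (q * real n) + n * ln (1 + (real q - 1) * y) - nat \<lfloor>rho * real n\<rfloor> * ln y < n * (ln q / (q + E))"
proof -
  define Lim where "Lim c = (real q - 2) * rho + 2 * sqrt ((real q - 1) * rho * (1 - rho)) * c" for c
  have "(\<lambda>m. pi / (real m + 1)) \<longlonglongrightarrow> 0"
    using LIMSEQ_Suc[OF lim_const_over_n[of pi]] by (simp add: add.commute)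
  then have "(\<lambda>m. Lim (cos (pi / (real m + 1)))) \<longlonglongrightarrow> Lim (cos 0)"
    unfolding Lim_def by (intro tendsto_intros)
  then have "\<forall>\<^sub>F m in sequentially. (q - 1) * E / (q + E) < Lim (cos (pi / (real m + 1)))"
    by (rule order_tendstoD(1)) (use H1 in \<open>simp add: Lim_def\<close>)
  then have "\<forall>\<^sub>F m in sequentially. 1 \<le> m \<and> (q - 1) * E / (q + E) < Lim (cos (pi / (real m + 1)))"
    using eventually_ge_at_top[of 1] by eventually_elim simp
  then obtain m where m: "1 \<le> m" "(q - 1) * E / (q + E) < Lim (cos (pi / (real m + 1)))"
    using eventually_happens'[OF sequentially_bot] by blast
  define c where "c = cos (pi / (real m + 1))"
  define r where "r n = nat \<lfloor>rho * real n\<rfloor>" for n :: nat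
  define x where "x n = real (r n) / real n" for n
  have r_le: "real (r n) \<le> rho * n" for n
    unfolding r_def using rho by (intro of_nat_floor) simp
  have r_ge: "rho * n - 1 \<le> real (r n)" for n
    unfolding r_def using rho by linarith
  have inv0: "(\<lambda>n. a / real n) \<longlonglongrightarrow> 0" for a :: real by (rule lim_const_over_n)
  have x: "x \<longlonglongrightarrow> rho"
  proof (rule tendsto_sandwich)
    show "\<forall>\<^sub>F n in sequentially. rho - 1 / real n \<le> x n"
      using eventually_gt_at_top[of 0]
    proof eventually_elim
      case (elim n)
      then have "rho - 1 / real n = (rho * n - 1) / n" by (simp add: diff_divide_distrib)
      also have "\<dots> \<le> x n" unfolding x_def by (intro divide_right_mono r_ge) simp
      finally show ?case .
    qed
    show "\<forall>\<^sub>F n in sequentially. x n \<le> rho"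
      using eventually_gt_at_top[of 0]
    proof eventually_elim
      case (elim n)
      then show ?case using r_le[of n] by (simp add: x_def field_simps)
    qed
    show "(\<lambda>n. rho - 1 / real n) \<longlonglongrightarrow> rho"
      using tendsto_diff[OF tendsto_const inv0] by simp
  qed simp
  have m_less: "\<forall>\<^sub>F n in sequentially. m < r n"
  proof -
    have "filterlim (\<lambda>n. rho * real n) at_top sequentially"
      using rho by (intro filterlim_tendsto_pos_mult_at_top[OF tendsto_const _ filterlim_real_sequentially])
    then have "\<forall>\<^sub>F n in sequentially. real m + 1 < rho * real n"
      by (simp add: filterlim_at_top_dense)
    then show ?thesis
    proof eventually_elim
      case (elim n)
      then show ?case using r_ge[of n] by linarith
    qed
  qed
  have r_less: "r n < n" if "0 < n" for n
  proof -
    have "rho * n < 1 * real n" using that rho by (intro mult_strict_right_mono) auto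
    then show ?thesis using r_le[of n] by linarith
  qed
  define lam where "lam n = (real (r n) - m) * (real q - 2) + 2 * (1 - m / r n) *
          sqrt ((real q - 1) * r n * (real n - r n)) * c" for n
  define low where "low n = (real q - 1) * n - q * ((real q - 1) * (n / (q + E) - 1) + 1) + 1" for n :: nat
  \<comment> \<open>\<open>(lam n - low n) / n\<close> in a form whose limit can be read off; the
    last term collects the part of \<open>low\<close> that does not grow.\<close>
  define dif where "dif n = (x n - m / n) * (real q - 2) + 2 * (1 - (m / n) / x n) *
          sqrt ((real q - 1) * x n * (1 - x n)) * c - ((real q - 1) - q * (real q - 1) / (q + E))
          - (q * (real q - 1) - q + 1) / n" for n :: nat
  have "dif \<longlonglongrightarrow> (rho - 0) * (real q - 2) + 2 * (1 - 0 / rho) * sqrt ((real q - 1) * rho * (1 - rho)) * c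
      - ((real q - 1) - q * (real q - 1) / (q + E)) - 0"
    unfolding dif_def using rho by (intro tendsto_intros x inv0) auto
  also have "(rho - 0) * (real q - 2) + 2 * (1 - 0 / rho) * sqrt ((real q - 1) * rho * (1 - rho)) * c
      - ((real q - 1) - q * (real q - 1) / (q + E)) - 0 = Lim c - (q - 1) * E / (q + E)"
  proof -
    have "(real q - 1) - q * (real q - 1) / (q + E) = (q - 1) * E / (q + E)"
      using q E by (simp add: field_simps of_nat_diff)
    then show ?thesis by (simp add: Lim_def)
  qed
  finally have "\<forall>\<^sub>F n in sequentially. 0 < dif n"
    by (rule order_tendstoD(1)) (use m in \<open>simp add: c_def\<close>)
  then have ev1: "\<forall>\<^sub>F n in sequentially. low n \<le> lam n"
    using m_less eventually_gt_at_top[of 0]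
  proof eventually_elim
    case (elim n)
    have n: "0 < real n" and rn: "0 < real (r n)" using elim by auto
    have rx: "real (r n) = n * x n" using n by (simp add: x_def)
    have "sqrt ((real q - 1) * r n * (real n - r n)) = sqrt (real n ^ 2 * ((real q - 1) * x n * (1 - x n)))"
      unfolding rx by (simp add: algebra_simps power2_eq_square)
    also have "\<dots> = n * sqrt ((real q - 1) * x n * (1 - x n))"
      by (simp only: real_sqrt_mult) simp
    finally have sq: "sqrt ((real q - 1) * r n * (real n - r n)) = n * sqrt ((real q - 1) * x n * (1 - x n))" .
    have "lam n = n * ((x n - m / n) * (real q - 2) + 2 * (1 - (m / n) / x n) *
          sqrt ((real q - 1) * x n * (1 - x n)) * c)"
    proof -
      have "real (r n) - m = n * (x n - m / n)" using n by (simp add: rx right_diff_distrib)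
      moreover have "real m / r n = (m / n) / x n" using n by (simp add: rx)
      moreover have "n * u * k + 2 * v * (n * s) * c = n * (u * k + 2 * v * s * c)" for u k v s :: real
        by (simp add: algebra_simps)
      ultimately show ?thesis unfolding lam_def sq by (simp only:)
    qed
    moreover have "low n = n * (((real q - 1) - q * (real q - 1) / (q + E)) + (q * (real q - 1) - q + 1) / n)"
    proof -
      have "n * (a + b / n) = n * a + b" for a b :: real using n by (simp add: distrib_left)
      then show ?thesis by (simp only:) (simp add: low_def algebra_simps)
    qed
    ultimately have "lam n - low n = n * dif n" by (simp add: dif_def algebra_simps)
    moreover have "0 \<le> n * dif n" using n elim by simp
    ultimately show ?case by linarith
  qed
  define lg where "lg n = ln (real q) / n + ln (real n) / n + (ln (1 + (real q - 1) * y) - x n * ln y)" for n :: nat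
  have "lg \<longlonglongrightarrow> 0 + 0 + (ln (1 + (real q - 1) * y) - rho * ln y)"
    unfolding lg_def by (intro tendsto_intros x inv0 lim_ln_over_n)
  then have "\<forall>\<^sub>F n in sequentially. lg n < ln q / (q + E)"
    by (rule order_tendstoD(2)) (use H2 in simp)
  then have ev2: "\<forall>\<^sub>F n in sequentially. ln (q * real n) + n * ln (1 + (real q - 1) * y) - r n * ln y < n * (ln q / (q + E))"
    using eventually_gt_at_top[of 0]
  proof eventually_elim
    case (elim n)
    then have n: "0 < real n" by simp
    have "ln (q * real n) + n * ln (1 + (real q - 1) * y) - r n * ln y = n * lg n"
      using n q by (simp add: lg_def x_def ln_mult algebra_simps)
    also have "\<dots> < n * (ln q / (q + E))" using n elim by (intro mult_strict_left_mono) auto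
    finally show ?case .
  qed
  have "\<forall>\<^sub>F n in sequentially. m < r n \<and> r n < n \<and> low n \<le> lam n \<and>
      ln (q * real n) + n * ln (1 + (real q - 1) * y) - r n * ln y < n * (ln q / (q + E))"
    using m_less ev1 ev2 eventually_gt_at_top[of 0] by eventually_elim (simp add: r_less)
  then show ?thesis
    using m(1) unfolding low_def lam_def c_def r_def by (intro exI[of _ m]) (simp add: add.commute)
qed

section \<open>The spectral and entropy conditions on the parameters\<close>

text \<open>The scaling of \<open>rho\<close> decouples \<open>q\<close> from \<open>E\<close> and
  \<open>c\<close>: once squared, the gap between the two sides is a positive multiple of
  \<open>q\<^sup>2 * (4 * c - (E - c)\<^sup>2)\<close>.\<close>

lemma spectral_inequality:
  fixes q E c :: real
  assumes q: "q \<ge> 2" and E: "E > 1" and c: "0 < c" "c < E" "(E - c)\<^sup>2 < 4 * c"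
  defines "rho \<equiv> (q - 1) * c / (q * (q + E))"
  shows "(q - 1) * E / (q + E) < (q - 2) * rho + 2 * sqrt ((q - 1) * rho * (1 - rho))"
proof -
  define D where "D = q * (q + E)"
  have D: "0 < D" using q E by (simp add: D_def)
  have "((E - c) * q + 2 * c)\<^sup>2 < 4 * c * (D - (q - 1) * c)"
  proof -
    have "4 * c * (D - (q - 1) * c) - ((E - c) * q + 2 * c)\<^sup>2 = q\<^sup>2 * (4 * c - (E - c)\<^sup>2)"
      unfolding D_def by (simp add: algebra_simps power2_eq_square)
    moreover have "0 < q\<^sup>2 * (4 * c - (E - c)\<^sup>2)" using q c by simp
    ultimately show ?thesis by linarith
  qed
  then have "(q - 1)\<^sup>2 / D\<^sup>2 * ((E - c) * q + 2 * c)\<^sup>2 < (q - 1)\<^sup>2 / D\<^sup>2 * (4 * c * (D - (q - 1) * c))"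
    using q D by (intro mult_strict_left_mono) auto
  also have "\<dots> = 4 * ((q - 1) * rho * (1 - rho))"
    using D unfolding rho_def D_def[symmetric] by (simp add: field_simps power2_eq_square)
  finally have "((q - 1) / D * ((E - c) * q + 2 * c))\<^sup>2 < 4 * ((q - 1) * rho * (1 - rho))"
    by (simp add: power_mult_distrib power_divide)
  then have "(q - 1) / D * ((E - c) * q + 2 * c) < sqrt (4 * ((q - 1) * rho * (1 - rho)))"
    by (rule real_less_rsqrt)
  also have "\<dots> = 2 * sqrt ((q - 1) * rho * (1 - rho))" by (simp add: real_sqrt_mult)
  also have "(q - 1) / D * ((E - c) * q + 2 * c) = (q - 1) * E / (q + E) - (q - 2) * rho"
  proof -
    have 1: "(q - 1) * E / (q + E) = (q - 1) * (E * q) / D" using q by (simp add: D_def)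
    have 2: "rho = (q - 1) * c / D" by (simp add: rho_def D_def)
    show ?thesis
      unfolding 1 2 by (simp add: algebra_simps add_divide_distrib diff_divide_distrib)
  qed
  finally show ?thesis by simp
qed


lemma ln_power_less:
  fixes X q a b :: nat
  assumes "0 < X" "0 < q" "X ^ a < q ^ b"
  shows "a * ln X < b * ln (real q)"
proof -
  have "real X ^ a < real q ^ b" using assms(3) by (metis of_nat_less_iff of_nat_power)
  then have "ln (real X ^ a) < ln (real q ^ b)" using assms by (subst ln_less_cancel_iff) auto
  then show ?thesis using assms by (simp add: ln_realpow)
qed

text \<open>As \<open>ln (1 + x) \<le> x\<close>, the left side is at most
  \<open>(q - 1) y ln (exp 1 / y)\<close>, and \<open>X\<close> bounds \<open>exp 1 / y\<close> from
  above through \<open>exp 1 < 272 / 100\<close>. Here \<open>y\<close> is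
  \<open>rho / (q - 1)\<close> for \<open>c = 7/20\<close>, close to the optimal Chernoff parameter
  \<open>rho / ((q - 1) (1 - rho))\<close>.\<close>

lemma entropy_inequality_aux:
  fixes q X :: nat
  assumes q: "q \<ge> 3" and X: "272 / 100 * q * (q + 1521 / 1000) * (20 / 7) \<le> real X"
    and ln: "real (7 * (q - 1)) * ln X < real (20 * q) * ln q"
  defines "y \<equiv> (7 / 20) / (q * (q + 1521 / 1000 :: real))"
  shows "ln (1 + (real q - 1) * y) - (real q - 1) * y * ln y < ln q / (q + 1521 / 1000)"
proof -
  define Q where "Q = real q"
  have Q: "3 \<le> Q" using q by (simp add: Q_def)
  have y: "0 < y" using Q by (simp add: y_def Q_def[symmetric])
  have "1 - ln y = ln (exp 1 / y)" using y by (simp add: ln_div)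
  also have "\<dots> \<le> ln X"
  proof (rule ln_mono)
    have "exp 1 / y \<le> (272 / 100) / y" using e_less_272 y by (intro divide_right_mono) auto
    also have "\<dots> = 272 / 100 * q * (q + 1521 / 1000) * (20 / 7)"
      using Q by (simp add: y_def Q_def[symmetric])
    finally show "exp 1 / y \<le> X" using X by linarith
  qed (use y in auto)
  finally have lnX: "1 - ln y \<le> ln X" .
  have "ln (1 + (Q - 1) * y) \<le> (Q - 1) * y" using Q y by (intro ln_add_one_self_le_self) auto
  then have "ln (1 + (Q - 1) * y) - (Q - 1) * y * ln y \<le> (Q - 1) * y * (1 - ln y)"
    by (simp add: algebra_simps)
  also have "\<dots> \<le> (Q - 1) * y * ln X" using Q y lnX by (intro mult_left_mono) auto
  also have "\<dots> = (7 * (Q - 1) * ln X) / (20 * Q * (Q + 1521 / 1000))"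
    using Q by (simp add: y_def Q_def[symmetric] divide_simps)
  also have "\<dots> < (20 * Q * ln q) / (20 * Q * (Q + 1521 / 1000))"
    using ln Q q by (intro divide_strict_right_mono) (simp_all add: Q_def of_nat_diff)
  also have "\<dots> = ln q / (Q + 1521 / 1000)" using Q by simp
  finally show ?thesis by (simp add: Q_def)
qed

text \<open>Any integer \<open>X\<close> above \<open>e / y\<close> with \<open>X\<^bsup>7 (q - 1)\<^esup> < q\<^bsup>20 q\<^esup>\<close> will do;
  \<open>X = 9 q\<^sup>2\<close> works from \<open>q = 10\<close> on.\<close>

lemma entropy_inequality:
  fixes q :: nat
  assumes q: "q \<ge> 3"
  defines "y \<equiv> (7 / 20) / (q * (q + 1521 / 1000 :: real))"
  shows "ln (1 + (real q - 1) * y) - (real q - 1) * y * ln y < ln q / (q + 1521 / 1000)"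
proof (cases "q \<ge> 10")
  case True
  have L: "0 < ln (real q)" using q by simp
  have ln9: "ln (real (9 * q\<^sup>2)) = ln 9 + 2 * ln (real q)"
    using q by (simp add: ln_mult_pos ln_realpow)
  have "real (7 * (q - 1)) * ln (real (9 * q\<^sup>2)) < real (20 * q) * ln (real q)"
  proof (cases "q \<ge> 16")
    case True
    \<comment> \<open>This gives \<open>ln 9 \<le> 4/5 ln q\<close>, and \<open>7 * 14/5\<close> is
      below 20.\<close>
    have "(9 :: real) ^ 5 \<le> 16 ^ 4" by simp
    also have "\<dots> \<le> real q ^ 4" using True by (intro power_mono) auto
    finally have "ln ((9 :: real) ^ 5) \<le> ln (real q ^ 4)" by (intro ln_mono) auto
    then have "5 * ln 9 \<le> 4 * ln (real q)" by (simp only: ln_realpow)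
    then have "real (7 * (q - 1)) * ln (real (9 * q\<^sup>2)) \<le> real (7 * (q - 1)) * (14 / 5 * ln (real q))"
      unfolding ln9 by (intro mult_left_mono) auto
    also have "\<dots> = (7 * (real q - 1) * (14 / 5)) * ln (real q)" using q by (simp add: of_nat_diff)
    also have "\<dots> < (20 * real q) * ln (real q)" using q L by (intro mult_strict_right_mono) auto
    finally show ?thesis by simp
  next
    case False
    \<comment> \<open>The cruder estimate suffices here, as \<open>21 (q - 1) < 20 q\<close> for
      \<open>q < 21\<close>.\<close>
    have "ln 9 \<le> ln (real q)" using True by (intro ln_mono) auto
    then have "real (7 * (q - 1)) * ln (real (9 * q\<^sup>2)) \<le> real (7 * (q - 1)) * (3 * ln (real q))"
      unfolding ln9 by (intro mult_left_mono) auto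
    also have "\<dots> = (7 * (real q - 1) * 3) * ln (real q)" using q by (simp add: of_nat_diff)
    also have "\<dots> < (20 * real q) * ln (real q)" using q False L by (intro mult_strict_right_mono) auto
    finally show ?thesis by simp
  qed
  then show ?thesis unfolding y_def
  proof (rule entropy_inequality_aux[OF q, rotated])
    have "272 / 100 * (q + 1521 / 1000) * (20 / 7) \<le> 9 * real q" using True by simp
    then have "real q * (272 / 100 * (q + 1521 / 1000) * (20 / 7)) \<le> real q * (9 * real q)"
      by (rule mult_left_mono) simp
    then show "272 / 100 * real q * (q + 1521 / 1000) * (20 / 7) \<le> real (9 * q\<^sup>2)"
      by (simp add: power2_eq_square algebra_simps)
  qed
next
  case False
  then have "q \<in> {3, 4, 5, 6, 7, 8, 9}"
    using q by (simp only: insert_iff empty_iff) presburger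
  moreover have bound: ?thesis
    if "272 / 100 * q * (q + 1521 / 1000) * (20 / 7) \<le> real X" "0 < X" "X ^ (7 * (q - 1)) < q ^ (20 * q)" for X
    unfolding y_def using q that by (intro entropy_inequality_aux[OF q that(1)] ln_power_less) auto
  ultimately show ?thesis
  proof (elim insertE emptyE)
    \<comment> \<open>Each witness is the least integer above
      \<open>272/100 * q * (q + 1521/1000) * 20/7\<close>.\<close>
    assume "q = 3"
    then show ?thesis by (intro bound[of 106]) simp_all
  next
    assume "q = 4"
    then show ?thesis by (intro bound[of 172]) simp_all
  next
    assume "q = 5"
    then show ?thesis by (intro bound[of 254]) simp_all
  next
    assume "q = 6"
    then show ?thesis by (intro bound[of 351]) simp_all
  next
    assume "q = 7"
    then show ?thesis by (intro bound[of 464]) simp_all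
  next
    assume "q = 8"
    then show ?thesis by (intro bound[of 592]) simp_all
  next
    assume "q = 9"
    then show ?thesis by (intro bound[of 736]) simp_all
  qed
qed

text \<open>Multiplied by 3521 the claim is \<open>3521 ln (21/20) + 173 ln 20 < 1000 ln 2\<close>;
  the two integer power comparisons bound the left side by about \<open>997.6 ln 2\<close>.\<close>

lemma entropy_inequality_2:
  "ln (1 + 1 / 20 :: real) - 173 / 3521 * ln (1 / 20) < ln 2 / (2 + 1521 / 1000)"
proof -
  have "(21 :: real) ^ 71 < 2 ^ 5 * 20 ^ 71" by simp
  then have "(21 / 20 :: real) ^ 71 < 2 ^ 5"
    unfolding power_divide by (subst pos_divide_less_eq) (rule zero_less_power, simp)
  then have "ln ((21 / 20 :: real) ^ 71) < ln (2 ^ 5)" by (subst ln_less_cancel_iff) auto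
  then have 1: "71 * ln (21 / 20 :: real) < 5 * ln 2" by (simp only: ln_realpow)
  have "ln ((20 :: real) ^ 3) < ln (2 ^ 13)" by (subst ln_less_cancel_iff) simp_all
  then have 2: "3 * ln (20 :: real) < 13 * ln 2" by (simp only: ln_realpow)
  have 3: "0 < ln (2 :: real)" by simp
  have 4: "ln (1 / 20 :: real) = - ln 20" by (simp add: ln_div)
  have "3521 * ln (21 / 20 :: real) + 173 * ln 20 < 1000 * ln 2" using 1 2 3 by linarith
  then show ?thesis unfolding 4 by simp
qed

section \<open>Linear codes over a finite field\<close>

abbreviation words :: "('a, 'b) ring_scheme \<Rightarrow> nat \<Rightarrow> (nat \<Rightarrow> 'a) set" where
  "words F n \<equiv> {..<n} \<rightarrow>\<^sub>E carrier F"

locale finite_field = field F for F :: "'a ring" (structure) +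
  assumes finite_carrier: "finite (carrier F)"
begin

text \<open>The library's subspaces of \<open>word_space\<close> spelled out, so that later
  arguments compute with coordinates only.\<close>

definition subspace_of_words :: "nat \<Rightarrow> (nat \<Rightarrow> 'a) set \<Rightarrow> bool" where
  "subspace_of_words n C \<longleftrightarrow> C \<subseteq> words F n \<and> (\<lambda>i\<in>{..<n}. \<zero>) \<in> C \<and>
     (\<forall>x\<in>C. \<forall>y\<in>C. (\<lambda>i\<in>{..<n}. x i \<oplus> y i) \<in> C) \<and>
     (\<forall>a\<in>carrier F. \<forall>x\<in>C. (\<lambda>i\<in>{..<n}. a \<otimes> x i) \<in> C)"

lemma subspace_of_wordsD:
  assumes "subspace_of_words n C"
  shows "\<And>x. x \<in> C \<Longrightarrow> x \<in> words F n"
    and "(\<lambda>i\<in>{..<n}. \<zero>) \<in> C"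
    and "\<And>x y. x \<in> C \<Longrightarrow> y \<in> C \<Longrightarrow> (\<lambda>i\<in>{..<n}. x i \<oplus> y i) \<in> C"
    and "\<And>a x. a \<in> carrier F \<Longrightarrow> x \<in> C \<Longrightarrow> (\<lambda>i\<in>{..<n}. a \<otimes> x i) \<in> C"
    and "\<And>x i. x \<in> C \<Longrightarrow> i < n \<Longrightarrow> x i \<in> carrier F"
  using assms unfolding subspace_of_words_def by (auto simp: subset_iff PiE_iff)

lemma subspace_of_words_lincomb:
  assumes "subspace_of_words n C" "x \<in> C" "y \<in> C" "a \<in> carrier F"
  shows "(\<lambda>i\<in>{..<n}. x i \<oplus> a \<otimes> y i) \<in> C"
proof -
  have "(\<lambda>i\<in>{..<n}. x i \<oplus> (\<lambda>i\<in>{..<n}. a \<otimes> y i) i) \<in> C"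
    by (intro subspace_of_wordsD(3,4)[OF assms(1)] assms)
  also have "(\<lambda>i\<in>{..<n}. x i \<oplus> (\<lambda>i\<in>{..<n}. a \<otimes> y i) i) = (\<lambda>i\<in>{..<n}. x i \<oplus> a \<otimes> y i)"
    by (auto intro!: restrict_ext)
  finally show ?thesis .
qed

lemma word_space_simps:
  "carrier (word_space F n) = words F n"
  "\<zero>\<^bsub>word_space F n\<^esub> = (\<lambda>i\<in>{..<n}. \<zero>)"
  "x \<oplus>\<^bsub>word_space F n\<^esub> y = (\<lambda>i\<in>{..<n}. x i \<oplus> y i)"
  "a \<odot>\<^bsub>word_space F n\<^esub> x = (\<lambda>i\<in>{..<n}. a \<otimes> x i)"
  by (simp_all add: func_space_def)

lemma vectorspace_word_space: "vectorspace F (word_space F n)"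
  using func_space_is_module[of "{..<n}"] field_axioms
  by (simp add: vectorspace_def module_def)

lemma subspace_word_space_iff:
  "VectorSpace.subspace F C (word_space F n) \<longleftrightarrow> subspace_of_words n C"
proof
  assume "VectorSpace.subspace F C (word_space F n)"
  then have "submodule F C (word_space F n)" by (rule subspace.submod)
  then show "subspace_of_words n C"
    unfolding submodule_def subspace_of_words_def word_space_simps by blast
next
  assume "subspace_of_words n C"
  then have "submodule F C (word_space F n)"
    unfolding submodule_def subspace_of_words_def word_space_simps
    using func_space_is_module[of "{..<n}"] by blast
  then show "VectorSpace.subspace F C (word_space F n)"
    using vectorspace_word_space by (simp add: subspace_def)
qed

lemma finite_words: "finite (words F n)"
  by (intro finite_PiE) (auto simp: finite_carrier)

lemma card_subspace_of_words:
  assumes "subspace_of_words n C"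
  shows "card C = card (carrier F) ^ vectorspace.dim F ((word_space F n)\<lparr>carrier := C\<rparr>)"
proof -
  interpret V: vectorspace F "(word_space F n)\<lparr>carrier := C\<rparr>"
    using vectorspace.subspace_is_vs[OF vectorspace_word_space subspace_word_space_iff[THEN iffD2, OF assms]] .
  have "C \<subseteq> words F n" using assms subspace_of_words_def by simp
  then have fin: "finite C" using finite_words by (rule finite_subset)
  have "V.gen_set C"
    using V.span_is_subset2[of C] V.in_own_span[of C] by simp
  then have "V.fin_dim" unfolding V.fin_dim_def using fin by (intro exI[of _ C]) simp
  from V.finite_basis_exists[OF this] obtain B where B: "finite B" "V.basis B" by (elim exE conjE)
  then have BC: "B \<subseteq> C" by (simp add: V.basis_def)
  have uniq: "\<And>v. v \<in> C \<Longrightarrow> \<exists>!a. a \<in> B \<rightarrow>\<^sub>E carrier F \<and> V.lincomb a B = v"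
    using V.basis_criterion[of B] B BC by simp
  have lin: "V.lincomb a B \<in> C" if "a \<in> B \<rightarrow>\<^sub>E carrier F" for a
    using V.lincomb_closed[of B a] BC that by (simp add: PiE_def)
  have "bij_betw (\<lambda>a. V.lincomb a B) (B \<rightarrow>\<^sub>E carrier F) C"
  proof (rule bij_betwI')
    fix a b assume "a \<in> B \<rightarrow>\<^sub>E carrier F" "b \<in> B \<rightarrow>\<^sub>E carrier F"
    then show "(V.lincomb a B = V.lincomb b B) = (a = b)"
      using uniq[OF lin[of a]] by metis
  next
    fix v assume "v \<in> C"
    then show "\<exists>a\<in>B \<rightarrow>\<^sub>E carrier F. v = V.lincomb a B" using uniq by metis
  qed (rule lin)
  then have "card C = card (B \<rightarrow>\<^sub>E carrier F)" by (metis bij_betw_same_card)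
  also have "\<dots> = card (carrier F) ^ card B" using B(1) by (simp add: card_PiE)
  finally show ?thesis using V.dim_basis B by simp
qed

lemma card_carrier_gt_1: "card (carrier F) > 1"
proof -
  have "card {\<zero>, \<one>} \<le> card (carrier F)" by (intro card_mono) (auto simp: finite_carrier)
  then show ?thesis using zero_not_one by simp
qed

text \<open>Trades dimension for cardinality; neither bases nor \<open>dim\<close> occur
  afterwards.\<close>

lemma linear_code_iff:
  "linear_code F n k C \<longleftrightarrow> subspace_of_words n C \<and> card C = card (carrier F) ^ k"
proof -
  have "(card (carrier F) ^ i = card (carrier F) ^ j) = (i = j)" for i j
    using power_inject_exp[OF card_carrier_gt_1] .
  then show ?thesis
    unfolding linear_code_def subspace_word_space_iff
    by (cases "subspace_of_words n C") (simp_all only: card_subspace_of_words simp_thms)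
qed

text \<open>Evaluating \<open>u\<close> at all functionals \<open>a u\<^sub>i + b u\<^sub>j\<close> gives a minimal code: the functional
  \<open>u\<^sub>j v\<^sub>i - u\<^sub>i v\<^sub>j\<close> in \<open>v\<close> vanishes at \<open>v = u\<close>, so a codeword with smaller support is a multiple.\<close>

lemma minimal_code_exists:
   "\<exists>n C. linear_code F n k C \<and> minimal_code F n C"
proof -
  define I where "I = {..<k} \<times> {..<k} \<times> carrier F \<times> carrier F"
  have "finite I" unfolding I_def using finite_carrier by auto
  define n where "n = card I"
  obtain h where h: "bij_betw h {..<n} I"
    using \<open>finite I\<close> unfolding n_def lessThan_atLeast0 using ex_bij_betw_nat_finite by blast
  define ev where "ev u = (\<lambda>l\<in>{..<n}. case h l of (i, j, a, b) \<Rightarrow> a \<otimes> u i \<oplus> b \<otimes> u j)" for u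
  have hI: "\<exists>i j a b. h l = (i, j, a, b) \<and> i < k \<and> j < k \<and> a \<in> carrier F \<and> b \<in> carrier F"
    if "l < n" for l
    using bij_betwE[OF h] that unfolding I_def by fastforce
  have hsurj: "\<exists>l<n. h l = (i, j, a, b)" if "i < k" "j < k" "a \<in> carrier F" "b \<in> carrier F" for i j a b
  proof -
    have "(i, j, a, b) \<in> h ` {..<n}" using h that unfolding bij_betw_def I_def by simp
    then show ?thesis by force
  qed
  have ev_at: "\<exists>l<n. \<forall>u. ev u l = a \<otimes> u i \<oplus> b \<otimes> u j"
    if ijab: "i < k" "j < k" "a \<in> carrier F" "b \<in> carrier F" for i j a b
    using hsurj[OF ijab] by (auto simp: ev_def)
  have uC: "u i \<in> carrier F" if "u \<in> words F k" "i < k" for u i using that by (auto simp: PiE_iff)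
  have ev_words: "ev u \<in> words F n" if "u \<in> words F k" for u
    unfolding ev_def
  proof (rule restrict_PiE_iff[THEN iffD2], rule ballI)
    fix l assume "l \<in> {..<n}"
    then obtain i j a b where "h l = (i, j, a, b)" "i < k" "j < k" "a \<in> carrier F" "b \<in> carrier F"
      using hI by blast
    then show "(case h l of (i, j, a, b) \<Rightarrow> a \<otimes> u i \<oplus> b \<otimes> u j) \<in> carrier F"
      using uC[OF that] by simp
  qed
  define C where "C = ev ` words F k"
  have inj: "inj_on ev (words F k)"
  proof (rule inj_onI)
    fix u v assume u: "u \<in> words F k" and v: "v \<in> words F k" and eq: "ev u = ev v"
    show "u = v"
    proof (rule PiE_ext[OF u v])
      fix i assume "i \<in> {..<k}"
      then have i: "i < k" by simp
      obtain l where "l < n" "\<forall>u. ev u l = \<one> \<otimes> u i \<oplus> \<zero> \<otimes> u i"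
        using ev_at[OF i i one_closed zero_closed] by blast
      then have "\<one> \<otimes> u i \<oplus> \<zero> \<otimes> u i = \<one> \<otimes> v i \<oplus> \<zero> \<otimes> v i" using eq by metis
      then show "u i = v i" using uC[OF u i] uC[OF v i] by simp
    qed
  qed
  have ev_add: "(\<lambda>l\<in>{..<n}. ev u l \<oplus> ev v l) = ev (\<lambda>i\<in>{..<k}. u i \<oplus> v i)"
    if u: "u \<in> words F k" and v: "v \<in> words F k" for u v
  proof
    fix l
    show "(\<lambda>l\<in>{..<n}. ev u l \<oplus> ev v l) l = ev (\<lambda>i\<in>{..<k}. u i \<oplus> v i) l"
    proof (cases "l < n")
      case True
      then obtain i j a b where *: "h l = (i, j, a, b)" "i < k" "j < k" "a \<in> carrier F" "b \<in> carrier F"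
        using hI by blast
      then show ?thesis using True uC[OF u] uC[OF v] by (simp add: ev_def r_distr a_ac)
    qed (simp add: ev_def)
  qed
  have ev_smult: "(\<lambda>l\<in>{..<n}. c \<otimes> ev u l) = ev (\<lambda>i\<in>{..<k}. c \<otimes> u i)"
    if u: "u \<in> words F k" and c: "c \<in> carrier F" for u c
  proof
    fix l
    show "(\<lambda>l\<in>{..<n}. c \<otimes> ev u l) l = ev (\<lambda>i\<in>{..<k}. c \<otimes> u i) l"
    proof (cases "l < n")
      case True
      then obtain i j a b where *: "h l = (i, j, a, b)" "i < k" "j < k" "a \<in> carrier F" "b \<in> carrier F"
        using hI by blast
      then show ?thesis using True uC[OF u] c by (simp add: ev_def r_distr m_ac)
    qed (simp add: ev_def)
  qed
  have ev_zero: "ev (\<lambda>i\<in>{..<k}. \<zero>) = (\<lambda>l\<in>{..<n}. \<zero>)"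
  proof
    fix l
    show "ev (\<lambda>i\<in>{..<k}. \<zero>) l = (\<lambda>l\<in>{..<n}. \<zero>) l"
      using hI[of l] by (cases "l < n") (auto simp: ev_def)
  qed
  have zeroW: "(\<lambda>i\<in>{..<k}. \<zero>) \<in> words F k" by auto
  have "subspace_of_words n C"
    unfolding subspace_of_words_def
  proof (intro conjI ballI)
    show "C \<subseteq> words F n" unfolding C_def using ev_words by blast
    show "(\<lambda>i\<in>{..<n}. \<zero>) \<in> C" 
      unfolding C_def using imageI[OF zeroW, of ev] ev_zero by simp
  next
    fix x y assume "x \<in> C" "y \<in> C"
    then obtain u v where uv: "u \<in> words F k" "v \<in> words F k" "x = ev u" "y = ev v"
      unfolding C_def by blast
    moreover have "(\<lambda>i\<in>{..<k}. u i \<oplus> v i) \<in> words F k" using uC[OF uv(1)] uC[OF uv(2)] by (simp add: restrict_PiE_iff)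
    ultimately show "(\<lambda>i\<in>{..<n}. x i \<oplus> y i) \<in> C" using ev_add[OF uv(1,2)] unfolding C_def by simp
  next
    fix a x assume a: "a \<in> carrier F" and "x \<in> C"
    then obtain u where u: "u \<in> words F k" "x = ev u" unfolding C_def by blast
    moreover have "(\<lambda>i\<in>{..<k}. a \<otimes> u i) \<in> words F k" using uC[OF u(1)] a by (simp add: restrict_PiE_iff)
    ultimately show "(\<lambda>i\<in>{..<n}. a \<otimes> x i) \<in> C" using ev_smult[OF u(1) a] unfolding C_def by simp
  qed
  moreover have "card C = card (carrier F) ^ k"
    unfolding C_def using card_image[OF inj] by (simp add: card_PiE)
  moreover have "minimal_code F n C"
    unfolding minimal_code_def minimal_codeword_def word_space_simps
  proof (intro ballI impI conjI)
    fix x assume "x \<in> C" and x0: "x \<noteq> (\<lambda>i\<in>{..<n}. \<zero>)"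
    show "\<not> (\<exists>y\<in>C. y \<noteq> (\<lambda>i\<in>{..<n}. \<zero>) \<and> support F n y \<subset> support F n x)"
    proof
      assume "\<exists>y\<in>C. y \<noteq> (\<lambda>i\<in>{..<n}. \<zero>) \<and> support F n y \<subset> support F n x"
      with \<open>x \<in> C\<close> obtain u v where u: "u \<in> words F k" "x = ev u" and v: "v \<in> words F k"
        and v0: "ev v \<noteq> (\<lambda>i\<in>{..<n}. \<zero>)" and sub: "support F n (ev v) \<subset> support F n (ev u)"
        unfolding C_def by blast
      have "u \<noteq> (\<lambda>i\<in>{..<k}. \<zero>)" using u x0 ev_zero by blast
      then obtain j where j: "j < k" "u j \<noteq> \<zero>"
        using u zeroW by (metis PiE_ext lessThan_iff restrict_apply')
      have uj: "u j \<in> carrier F" using uC u j by blast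
      have rel: "u j \<otimes> v i = u i \<otimes> v j" if i: "i < k" for i
      proof -
        have ui: "u i \<in> carrier F" "\<ominus> u i \<in> carrier F" using uC u i by auto
        have vi: "v i \<in> carrier F" "v j \<in> carrier F" using uC v i j by auto
        obtain l where l: "l < n" "\<forall>u'. ev u' l = u j \<otimes> u' i \<oplus> (\<ominus> u i) \<otimes> u' j"
          using ev_at[OF i j(1) uj ui(2)] by blast
        have "ev u l = \<zero>" using l(2) ui(1) uj by (simp add: l_minus r_minus m_comm[of "u i" "u j"] r_neg)
        then have "ev v l = \<zero>" using sub l(1) unfolding support_def by blast
        then have "u j \<otimes> v i \<oplus> \<ominus> (u i \<otimes> v j) = \<zero>" using l(2) ui vi uj by (simp add: l_minus)
        then show ?thesis using ui vi uj by (metis m_closed minus_equality minus_minus a_inv_closed)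
      qed
      \<comment> \<open>With both \<open>u j\<close> and \<open>v j\<close> nonzero, the codewords
        \<open>ev u\<close> and \<open>ev v\<close> are proportional and have equal
        supports.\<close>
      have vj: "v j \<noteq> \<zero>"
      proof
        assume "v j = \<zero>"
        then have "v i = \<zero>" if "i < k" for i
          using rel[OF that] j uj uC[OF u(1) that] uC[OF v that] by (simp add: integral_iff)
        then have "v = (\<lambda>i\<in>{..<k}. \<zero>)" using v zeroW by (intro PiE_ext[OF v zeroW]) auto
        then show False using v0 ev_zero by blast
      qed
      have vj': "v j \<in> carrier F" using uC v j by blast
      have "(\<lambda>i\<in>{..<k}. u j \<otimes> v i) = (\<lambda>i\<in>{..<k}. v j \<otimes> u i)"
        using rel vj' uC[OF u(1)] by (intro restrict_ext) (simp add: m_comm)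
      then have "(\<lambda>l\<in>{..<n}. u j \<otimes> ev v l) = (\<lambda>l\<in>{..<n}. v j \<otimes> ev u l)"
        using ev_smult[OF v uj] ev_smult[OF u(1) vj'] by simp
      then have *: "u j \<otimes> ev v l = v j \<otimes> ev u l" if "l < n" for l
        using that by (metis lessThan_iff restrict_apply')
      have evC: "ev u l \<in> carrier F" "ev v l \<in> carrier F" if "l < n" for l
        using ev_words[OF u(1)] ev_words[OF v] that by (auto simp: PiE_iff)
      have "support F n (ev u) \<subseteq> support F n (ev v)"
        unfolding support_def using * evC uj vj vj' by (auto) (metis integral_iff r_null)
      then show False using sub by blast
    qed
  qed
  ultimately show ?thesis using linear_code_iff by blast
qed

section \<open>The minimum weight of a minimal code\<close>

text \<open>For \<open>s > 0\<close>, \<open>x [^] s = \<one>\<close> has at most \<open>s\<close>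
  roots, so some nonzero \<open>a\<close> has \<open>a [^] s \<noteq> \<one>\<close>; substituting
  \<open>a \<otimes> t\<close> for \<open>t\<close> multiplies the sum by \<open>a [^] s\<close>.
  For \<open>s = 0\<close> the sum is \<open>card (carrier F)\<close> times
  \<open>\<one>\<close>.\<close>

lemma finsum_power_eq_zero:
  assumes "s < card (carrier F) - 1"
  shows "(\<Oplus>t\<in>carrier F. t [^] s) = \<zero>"
proof (cases "s = 0")
  case True
  have "(\<Oplus>t\<in>carrier F. t [^] s) = (\<Oplus>t\<in>carrier F. \<one>)" using True by simp
  also have "\<dots> = \<zero>"
    using add.finprod_const[OF one_closed, of "carrier F"] add.power_order_eq_one[OF _ one_closed] finite_carrier
    by simp
  finally show ?thesis .
next
  case False
  let ?S = "\<Oplus>t\<in>carrier F. t [^] s"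
  have S: "?S \<in> carrier F" by (intro finsum_closed) auto
  have "\<exists>a\<in>carrier F - {\<zero>}. a [^] s \<noteq> \<one>"
  proof (rule ccontr)
    assume "\<not> ?thesis"
    then have "carrier F - {\<zero>} \<subseteq> {x \<in> carrier F. x [^] s = \<one>}" by blast
    then have "card (carrier F - {\<zero>}) \<le> card {x \<in> carrier F. x [^] s = \<one>}"
      using finite_carrier by (intro card_mono) auto
    also have "\<dots> \<le> s" using num_roots_le_deg[OF finite_carrier False] .
    finally show False using assms by (simp add: card_Diff_singleton)
  qed
  then obtain a where a: "a \<in> carrier F" "a \<noteq> \<zero>" "a [^] s \<noteq> \<one>" by blast
  have inj: "inj_on (\<lambda>t. a \<otimes> t) (carrier F)"
    using a by (intro inj_onI) (simp add: m_lcancel)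
  have img: "(\<lambda>t. a \<otimes> t) ` carrier F = carrier F"
    using a inj finite_carrier by (intro endo_inj_surj) auto
  have "?S = (\<Oplus>t\<in>(\<lambda>t. a \<otimes> t) ` carrier F. t [^] s)" using img by simp
  also have "\<dots> = (\<Oplus>t\<in>carrier F. (a \<otimes> t) [^] s)"
    using inj img by (intro finsum_reindex) auto
  also have "\<dots> = (\<Oplus>t\<in>carrier F. a [^] s \<otimes> t [^] s)"
    using a by (intro finsum_cong') (auto simp: nat_pow_distrib)
  also have "\<dots> = a [^] s \<otimes> ?S"
    using a by (intro finsum_rdistr[symmetric] finite_carrier) auto
  finally have "?S \<otimes> (a [^] s) = ?S \<otimes> \<one>" using S a by (simp add: m_comm)
  then show ?thesis using m_lcancel[of ?S "a [^] s" \<one>] S a by auto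
qed

section \<open>Polynomial functions of bounded degree\<close>

text \<open>A degree bound for functions rather than polynomials: \<open>ext\<close> identifies
  expressions with equal values on words, and only upper bounds are needed.\<close>

inductive poly_deg :: "nat \<Rightarrow> nat \<Rightarrow> ((nat \<Rightarrow> 'a) \<Rightarrow> 'a) \<Rightarrow> bool" for n where
  const: "a \<in> carrier F \<Longrightarrow> poly_deg n N (\<lambda>_. a)"
| add: "poly_deg n N f \<Longrightarrow> poly_deg n N g \<Longrightarrow> poly_deg n N (\<lambda>y. f y \<oplus> g y)"
| coord: "i < n \<Longrightarrow> poly_deg n N f \<Longrightarrow> poly_deg n (Suc N) (\<lambda>y. y i \<otimes> f y)"
| weaken: "poly_deg n N f \<Longrightarrow> N \<le> M \<Longrightarrow> poly_deg n M f"
| ext: "poly_deg n N f \<Longrightarrow> (\<And>y. y \<in> words F n \<Longrightarrow> f y = g y) \<Longrightarrow> poly_deg n N g"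

lemma poly_deg_closed: "poly_deg n N f \<Longrightarrow> y \<in> words F n \<Longrightarrow> f y \<in> carrier F"
  by (induction rule: poly_deg.induct) (auto simp: PiE_iff)

lemma poly_deg_smult:
  assumes "poly_deg n N f" "a \<in> carrier F"
  shows "poly_deg n N (\<lambda>y. a \<otimes> f y)"
  using assms(1)
proof induction
  case (const b N)
  then show ?case using poly_deg.const[of "a \<otimes> b"] assms(2) by simp
next
  case (add N f g)
  show ?case
    by (rule poly_deg.ext[OF poly_deg.add[OF add.IH]])
      (simp add: r_distr assms(2) poly_deg_closed[OF add.hyps(1)] poly_deg_closed[OF add.hyps(2)])
next
  case (coord i N f)
  show ?case
    by (rule poly_deg.ext[OF poly_deg.coord[OF coord.hyps(1) coord.IH]])
      (use coord.hyps in \<open>simp add: m_lcomm assms(2) poly_deg_closed[OF coord.hyps(2)] PiE_iff\<close>)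
next
  case (weaken N f M)
  then show ?case by (blast intro: poly_deg.weaken)
next
  case (ext N f g)
  show ?case by (rule poly_deg.ext[OF ext.IH]) (simp add: ext.hyps)
qed

text \<open>Degree at most \<open>K - (q - 1)\<close>, read as the zero function when this is negative.\<close>

definition reduced_deg :: "nat \<Rightarrow> nat \<Rightarrow> ((nat \<Rightarrow> 'a) \<Rightarrow> 'a) \<Rightarrow> bool" where
  "reduced_deg n K g \<longleftrightarrow>
     (if K < card (carrier F) - 1 then \<forall>y\<in>words F n. g y = \<zero>
      else poly_deg n (K - (card (carrier F) - 1)) g)"

lemma reduced_deg_zero:
  assumes "\<And>y. y \<in> words F n \<Longrightarrow> g y = \<zero>"
  shows "reduced_deg n K g"
  unfolding reduced_deg_def
  using poly_deg.ext[OF poly_deg.const[OF zero_closed], of n g] assms by simp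

lemma reduced_deg_mono:
  assumes "reduced_deg n K g" "K \<le> L"
  shows "reduced_deg n L g"
proof (cases "K < card (carrier F) - 1")
  case True
  then show ?thesis using assms by (intro reduced_deg_zero) (simp add: reduced_deg_def)
next
  case False
  then show ?thesis using assms unfolding reduced_deg_def by (auto intro: poly_deg.weaken)
qed

lemma reduced_deg_cong:
  assumes "reduced_deg n K f" "\<And>y. y \<in> words F n \<Longrightarrow> f y = g y"
  shows "reduced_deg n K g"
  using assms unfolding reduced_deg_def by (auto intro: poly_deg.ext split: if_splits)

lemma reduced_deg_add:
  assumes "reduced_deg n K f" "reduced_deg n K g"
  shows "reduced_deg n K (\<lambda>y. f y \<oplus> g y)"
  using assms unfolding reduced_deg_def by (auto intro: poly_deg.add split: if_splits)

lemma reduced_deg_smult: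
  assumes "reduced_deg n K f" "a \<in> carrier F"
  shows "reduced_deg n K (\<lambda>y. a \<otimes> f y)"
  using assms unfolding reduced_deg_def by (auto intro: poly_deg_smult split: if_splits)

lemma reduced_deg_coord:
  assumes "reduced_deg n K f" "i < n"
  shows "reduced_deg n (Suc K) (\<lambda>y. y i \<otimes> f y)"
proof (cases "K < card (carrier F) - 1")
  case True
  then show ?thesis
    using assms by (intro reduced_deg_zero) (auto simp: reduced_deg_def PiE_iff)
next
  case False
  then show ?thesis
    using assms poly_deg.coord[OF assms(2), of "K - (card (carrier F) - 1)" f]
    unfolding reduced_deg_def by (simp add: Suc_diff_le)
qed

lemma line_word: "e \<in> words F n \<Longrightarrow> t \<in> carrier F \<Longrightarrow> y \<in> words F n \<Longrightarrow>
    (\<lambda>i\<in>{..<n}. y i \<oplus> t \<otimes> e i) \<in> words F n"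
  by (auto simp: restrict_PiE_iff PiE_iff)

text \<open>The power sums of exponent less than \<open>q - 1\<close> over the field vanish, so summing over a line
  lowers the degree by \<open>q - 1\<close>.\<close>

lemma reduced_deg_line_sum:
  assumes "poly_deg n N f" and e: "e \<in> words F n"
  shows "reduced_deg n (N + s) (\<lambda>y. \<Oplus>t\<in>carrier F. t [^] s \<otimes> f (\<lambda>i\<in>{..<n}. y i \<oplus> t \<otimes> e i))"
  using assms(1)
proof (induction arbitrary: s)
  case (const a N)
  have eq: "(\<Oplus>t\<in>carrier F. t [^] s \<otimes> a) = (\<Oplus>t\<in>carrier F. t [^] s) \<otimes> a"
    using const by (intro finsum_ldistr[symmetric] finite_carrier) auto
  show ?case
  proof (cases "s < card (carrier F) - 1")
    case True
    then show ?thesis unfolding eq using const finsum_power_eq_zero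
      by (intro reduced_deg_zero) simp
  next
    case False
    then show ?thesis unfolding eq reduced_deg_def using const
      by (auto intro!: poly_deg.const finsum_closed)
  qed
next
  case (add N f g)
  note cl = poly_deg_closed[OF add.hyps(1)] poly_deg_closed[OF add.hyps(2)]
  show ?case
  proof (rule reduced_deg_cong[OF reduced_deg_add[OF add.IH(1)[of s] add.IH(2)[of s]]])
    fix y assume y: "y \<in> words F n"
    show "(\<Oplus>t\<in>carrier F. t [^] s \<otimes> f (\<lambda>i\<in>{..<n}. y i \<oplus> t \<otimes> e i)) \<oplus>
        (\<Oplus>t\<in>carrier F. t [^] s \<otimes> g (\<lambda>i\<in>{..<n}. y i \<oplus> t \<otimes> e i)) =
      (\<Oplus>t\<in>carrier F. t [^] s \<otimes> (f (\<lambda>i\<in>{..<n}. y i \<oplus> t \<otimes> e i) \<oplus> g (\<lambda>i\<in>{..<n}. y i \<oplus> t \<otimes> e i)))"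
    proof -
      have "f (\<lambda>i\<in>{..<n}. y i \<oplus> t \<otimes> e i) \<in> carrier F" "g (\<lambda>i\<in>{..<n}. y i \<oplus> t \<otimes> e i) \<in> carrier F"
        if "t \<in> carrier F" for t using cl line_word[OF e that y] by blast+
      then have cl: "\<And>t. t \<in> carrier F \<Longrightarrow> f (\<lambda>i\<in>{..<n}. y i \<oplus> t \<otimes> e i) \<in> carrier F"
        "\<And>t. t \<in> carrier F \<Longrightarrow> g (\<lambda>i\<in>{..<n}. y i \<oplus> t \<otimes> e i) \<in> carrier F" by blast+
      have "(\<Oplus>t\<in>carrier F. t [^] s \<otimes> (f (\<lambda>i\<in>{..<n}. y i \<oplus> t \<otimes> e i) \<oplus> g (\<lambda>i\<in>{..<n}. y i \<oplus> t \<otimes> e i))) =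
        (\<Oplus>t\<in>carrier F. t [^] s \<otimes> f (\<lambda>i\<in>{..<n}. y i \<oplus> t \<otimes> e i) \<oplus> t [^] s \<otimes> g (\<lambda>i\<in>{..<n}. y i \<oplus> t \<otimes> e i))"
        using cl by (intro finsum_cong' refl funcsetI r_distr) simp_all
      then show ?thesis using cl by (simp only:) (intro finsum_addf[symmetric] funcsetI, simp_all)
    qed
  qed
next
  case (coord j N f)
  note cl = poly_deg_closed[OF coord.hyps(2)]
  have ej: "e j \<in> carrier F" using e coord by (auto simp: PiE_iff)
  have 1: "reduced_deg n (Suc N + s) (\<lambda>y. y j \<otimes> (\<Oplus>t\<in>carrier F. t [^] s \<otimes> f (\<lambda>i\<in>{..<n}. y i \<oplus> t \<otimes> e i)))"
    using reduced_deg_coord[OF coord.IH[of s] coord.hyps(1)] by (simp only: add_Suc)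
  \<comment> \<open>The term \<open>t \<otimes> e j\<close> of the moved coordinate turns
    \<open>t [^] s\<close> into \<open>t [^] Suc s\<close> while \<open>f\<close> has degree one
    less, so the total is unchanged. This is why the induction carries \<open>s\<close>.\<close>
  have 2: "reduced_deg n (Suc N + s) (\<lambda>y. e j \<otimes> (\<Oplus>t\<in>carrier F. t [^] Suc s \<otimes> f (\<lambda>i\<in>{..<n}. y i \<oplus> t \<otimes> e i)))"
    using reduced_deg_smult[OF coord.IH[of "Suc s"] ej] by (simp only: add_Suc add_Suc_right)
  show ?case
  proof (rule reduced_deg_cong[OF reduced_deg_add[OF 1 2]])
    fix y assume y: "y \<in> words F n"
    have yj: "y j \<in> carrier F" using y coord by (auto simp: PiE_iff)
    let ?f = "\<lambda>t. f (\<lambda>i\<in>{..<n}. y i \<oplus> t \<otimes> e i)"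
    have f: "?f t \<in> carrier F" if "t \<in> carrier F" for t using cl line_word[OF e that y] by blast
    have "y j \<otimes> (\<Oplus>t\<in>carrier F. t [^] s \<otimes> ?f t) = (\<Oplus>t\<in>carrier F. y j \<otimes> (t [^] s \<otimes> ?f t))"
      using f yj by (intro finsum_rdistr finite_carrier) auto
    moreover have "e j \<otimes> (\<Oplus>t\<in>carrier F. t [^] Suc s \<otimes> ?f t) = (\<Oplus>t\<in>carrier F. e j \<otimes> (t [^] Suc s \<otimes> ?f t))"
      using f ej by (intro finsum_rdistr finite_carrier) auto
    moreover have "(\<Oplus>t\<in>carrier F. y j \<otimes> (t [^] s \<otimes> ?f t)) \<oplus> (\<Oplus>t\<in>carrier F. e j \<otimes> (t [^] Suc s \<otimes> ?f t)) =
      (\<Oplus>t\<in>carrier F. y j \<otimes> (t [^] s \<otimes> ?f t) \<oplus> e j \<otimes> (t [^] Suc s \<otimes> ?f t))"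
      using f yj ej by (intro finsum_addf[symmetric]) auto
    moreover have "\<dots> = (\<Oplus>t\<in>carrier F. t [^] s \<otimes> ((\<lambda>i\<in>{..<n}. y i \<oplus> t \<otimes> e i) j \<otimes> ?f t))"
    proof (intro finsum_cong' refl)
      fix t assume t: "t \<in> carrier F"
      show "y j \<otimes> (t [^] s \<otimes> ?f t) \<oplus> e j \<otimes> (t [^] Suc s \<otimes> ?f t) =
        t [^] s \<otimes> ((\<lambda>i\<in>{..<n}. y i \<oplus> t \<otimes> e i) j \<otimes> ?f t)"
        using t f[OF t] yj ej coord.hyps(1) by (simp add: l_distr r_distr m_ac)
    qed (use f yj ej coord.hyps(1) in auto)
    ultimately show "y j \<otimes> (\<Oplus>t\<in>carrier F. t [^] s \<otimes> ?f t) \<oplus>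
        e j \<otimes> (\<Oplus>t\<in>carrier F. t [^] Suc s \<otimes> ?f t) =
      (\<Oplus>t\<in>carrier F. t [^] s \<otimes> ((\<lambda>i\<in>{..<n}. y i \<oplus> t \<otimes> e i) j \<otimes> ?f t))" by simp
  qed
next
  case (weaken N f M)
  then show ?case using reduced_deg_mono[OF weaken.IH[of s]] by simp
next
  case (ext N f g)
  show ?case
  proof (rule reduced_deg_cong[OF ext.IH[of s]])
    fix y assume y: "y \<in> words F n"
    have "f (\<lambda>i\<in>{..<n}. y i \<oplus> t \<otimes> e i) = g (\<lambda>i\<in>{..<n}. y i \<oplus> t \<otimes> e i)"
      "f (\<lambda>i\<in>{..<n}. y i \<oplus> t \<otimes> e i) \<in> carrier F" if "t \<in> carrier F" for t
      using ext.hyps(2) poly_deg_closed[OF ext.hyps(1)] line_word[OF e that y] by simp_all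
    then show "(\<Oplus>t\<in>carrier F. t [^] s \<otimes> f (\<lambda>i\<in>{..<n}. y i \<oplus> t \<otimes> e i)) =
      (\<Oplus>t\<in>carrier F. t [^] s \<otimes> g (\<lambda>i\<in>{..<n}. y i \<oplus> t \<otimes> e i))"
      by (intro finsum_cong' refl funcsetI) (metis nat_pow_closed m_closed)+
  qed
qed



section \<open>Slicing a subspace into parallel lines\<close>

definition line_through :: "nat \<Rightarrow> (nat \<Rightarrow> 'a) \<Rightarrow> (nat \<Rightarrow> 'a) \<Rightarrow> 'a \<Rightarrow> nat \<Rightarrow> 'a" where
  "line_through n e y t = (\<lambda>i\<in>{..<n}. y i \<oplus> t \<otimes> e i)"

definition coord_section :: "nat \<Rightarrow> (nat \<Rightarrow> 'a) set \<Rightarrow> (nat \<Rightarrow> 'a) set" where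
  "coord_section j V = {y \<in> V. y j = \<zero>}"

lemma subspace_coord_section:
  assumes V: "subspace_of_words n V" and j: "j < n"
  shows "subspace_of_words n (coord_section j V)"
  unfolding subspace_of_words_def
proof (intro conjI ballI)
  note VD = subspace_of_wordsD[OF V]
  show "coord_section j V \<subseteq> words F n" using VD(1) by (auto simp: coord_section_def)
  show "(\<lambda>i\<in>{..<n}. \<zero>) \<in> coord_section j V" using VD(2) j by (simp add: coord_section_def)
  fix x y assume "x \<in> coord_section j V" "y \<in> coord_section j V"
  then show "(\<lambda>i\<in>{..<n}. x i \<oplus> y i) \<in> coord_section j V"
    using VD(3) j by (simp add: coord_section_def)
next
  fix a x assume "a \<in> carrier F" "x \<in> coord_section j V"
  then show "(\<lambda>i\<in>{..<n}. a \<otimes> x i) \<in> coord_section j V"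
    using subspace_of_wordsD(4)[OF V] j by (simp add: coord_section_def)
qed

text \<open>Since \<open>e j = \<one>\<close> and \<open>W\<close> vanishes at \<open>j\<close>, the
  parameter of a point on its line is its \<open>j\<close>-th coordinate; hence the lines in
  direction \<open>e\<close> through \<open>W\<close> partition \<open>V\<close>.\<close>

lemma
  assumes V: "subspace_of_words n V" and e: "e \<in> V" "j < n" "e j = \<one>"
  defines "W \<equiv> coord_section j V"
  shows line_through_in: "\<And>y t. y \<in> W \<Longrightarrow> t \<in> carrier F \<Longrightarrow> line_through n e y t \<in> V"
    and line_through_inj: "\<And>y. y \<in> W \<Longrightarrow> inj_on (line_through n e y) (carrier F)"
    and line_through_disjoint:
      "pairwise (\<lambda>y y'. disjnt (line_through n e y ` carrier F) (line_through n e y' ` carrier F)) W"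
    and line_through_cover: "V = (\<Union>y\<in>W. line_through n e y ` carrier F)"
    and card_coord_section: "card V = card W * card (carrier F)"
proof -
  note VD = subspace_of_wordsD[OF V]
  note j = e(2) and e1 = e(3)
  have "V \<subseteq> words F n" using VD(1) by blast
  then have finV: "finite V" using finite_words[of n] by (rule finite_subset)
  have eC: "e i \<in> carrier F" if "i < n" for i using VD(5)[OF e(1) that] .
  have W: "W \<subseteq> V" "finite W" using finV by (auto simp: W_def coord_section_def)
  have line_j: "line_through n e y t j = t" if "y \<in> W" "t \<in> carrier F" for y t
    using that j e1 by (simp add: line_through_def W_def coord_section_def)
  show line_V: "line_through n e y t \<in> V" if "y \<in> W" "t \<in> carrier F" for y t
    unfolding line_through_def using subspace_of_words_lincomb[OF V _ e(1) that(2)] that W by blast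
  show inj: "inj_on (line_through n e y) (carrier F)" if "y \<in> W" for y
    using line_j[OF that] by (intro inj_onI) metis
  have line_inj: "y = y'" if y: "y \<in> W" "y' \<in> W" "t \<in> carrier F" "t' \<in> carrier F"
    "line_through n e y t = line_through n e y' t'" for y y' t t'
  proof (rule PiE_ext[OF VD(1) VD(1)])
    show "y \<in> V" "y' \<in> V" using y W by blast+
    have tt: "t' = t" using y line_j by metis
    fix i assume "i \<in> {..<n}"
    then have i: "i < n" by simp
    then have "y i \<oplus> t \<otimes> e i = y' i \<oplus> t \<otimes> e i"
      using fun_cong[OF y(5), of i] tt by (simp add: line_through_def)
    then show "y i = y' i" using VD(5)[OF subsetD[OF W(1) y(1)] i] VD(5)[OF subsetD[OF W(1) y(2)] i] eC[OF i] y(3) by simp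
  qed
  have cover: "\<exists>y\<in>W. \<exists>t\<in>carrier F. v = line_through n e y t" if v: "v \<in> V" for v
  proof -
    have vj: "v j \<in> carrier F" using VD(5) v j by blast
    let ?y = "\<lambda>i\<in>{..<n}. v i \<oplus> (\<ominus> v j) \<otimes> e i"
    have yW: "?y \<in> W"
      using subspace_of_words_lincomb[OF V v e(1), of "\<ominus> v j"] vj j e1
      by (simp add: W_def coord_section_def r_neg)
    have "v = line_through n e ?y (v j)"
    proof (rule PiE_ext[OF VD(1)[OF v] VD(1)[OF line_V[OF yW vj]]])
      fix i assume "i \<in> {..<n}"
      then have i: "i < n" by simp
      then show "v i = line_through n e ?y (v j) i"
        using VD(5)[OF v i] eC[OF i] vj by (simp add: line_through_def a_assoc l_minus l_neg)
    qed
    then show ?thesis using vj yW by blast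
  qed
  show VU: "V = (\<Union>y\<in>W. line_through n e y ` carrier F)" using cover line_V by blast
  show disj: "pairwise (\<lambda>y y'. disjnt (line_through n e y ` carrier F) (line_through n e y' ` carrier F)) W"
    unfolding pairwise_def disjnt_def using line_inj by blast
  have "card V = (\<Sum>y\<in>W. card (line_through n e y ` carrier F))"
    by (subst VU, rule card_UN_disjoint)
      (use W finite_carrier disj in \<open>auto simp: pairwise_def disjnt_def\<close>)
  also have "\<dots> = card W * card (carrier F)" using inj by (simp add: card_image)
  finally show "card V = card W * card (carrier F)" .
qed

lemma normalize_coord:
  assumes V: "subspace_of_words n V" and e: "e \<in> V" "j < n" "e j \<noteq> \<zero>"
  obtains e' where "e' \<in> V" "e' j = \<one>"
proof
  have ej: "e j \<in> carrier F" using subspace_of_wordsD(5)[OF V] e by blast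
  then show "(\<lambda>i\<in>{..<n}. inv (e j) \<otimes> e i) \<in> V"
    using e by (intro subspace_of_wordsD(4)[OF V]) (auto simp: field_Units)
  show "(\<lambda>i\<in>{..<n}. inv (e j) \<otimes> e i) j = \<one>" using ej e by (simp add: field_Units)
qed

lemma nonzero_coord:
  assumes "x \<in> words F n" "x \<noteq> (\<lambda>i\<in>{..<n}. \<zero>)"
  obtains j where "j < n" "x j \<noteq> \<zero>"
proof -
  have "(\<lambda>i\<in>{..<n}. \<zero>) \<in> words F n" by (simp add: restrict_PiE_iff)
  then have "x = (\<lambda>i\<in>{..<n}. \<zero>)" if "\<And>j. j < n \<Longrightarrow> x j = \<zero>"
    using that by (intro PiE_ext[OF assms(1)]) auto
  then show ?thesis using that assms(2) by metis
qed

text \<open>Summing first along parallel lines replaces \<open>V\<close> by a hyperplane section and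
  \<open>f\<close> by its line sums: one dimension and \<open>q - 1\<close> degrees are lost, so the
  strict inequality survives, unless the line sums already vanish.\<close>

lemma sum_poly_deg_eq_zero:
  assumes "subspace_of_words n V" "card V = card (carrier F) ^ m"
    and "poly_deg n N f" "N < m * (card (carrier F) - 1)"
  shows "(\<Oplus>y\<in>V. f y) = \<zero>"
  using assms
proof (induction m arbitrary: V N f)
  case (Suc m)
  let ?q = "card (carrier F)"
  note V = subspace_of_wordsD[OF Suc.prems(1)]
  have "1 < card V"
    unfolding Suc.prems(2) using one_less_power[OF card_carrier_gt_1, of "Suc m"] by blast
  have "\<exists>e\<in>V. e \<noteq> (\<lambda>i\<in>{..<n}. \<zero>)"
  proof (rule ccontr)
    assume "\<not> ?thesis"
    then have "card V \<le> card {\<lambda>i\<in>{..<n}. \<zero>}" by (intro card_mono) auto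
    then show False using \<open>1 < card V\<close> by simp
  qed
  then obtain e0 where e0: "e0 \<in> V" "e0 \<noteq> (\<lambda>i\<in>{..<n}. \<zero>)" by blast
  then obtain j where j: "j < n" "e0 j \<noteq> \<zero>" using nonzero_coord[OF V(1)] by blast
  then obtain e where e: "e \<in> V" "e j = \<one>"
    using normalize_coord[OF Suc.prems(1) e0(1)] by blast
  define W where "W = coord_section j V"
  note line = line_through_in[OF Suc.prems(1) e(1) j(1) e(2), folded W_def]
    line_through_inj[OF Suc.prems(1) e(1) j(1) e(2), folded W_def]
    line_through_disjoint[OF Suc.prems(1) e(1) j(1) e(2), folded W_def]
    line_through_cover[OF Suc.prems(1) e(1) j(1) e(2), folded W_def]
    card_coord_section[OF Suc.prems(1) e(1) j(1) e(2), folded W_def]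
  have WV: "W \<subseteq> V" by (auto simp: W_def coord_section_def)
  then have "W \<subseteq> words F n" using V(1) by blast
  then have finW: "finite W" using finite_words[of n] by (rule finite_subset)
  have subW: "subspace_of_words n W"
    unfolding W_def by (rule subspace_coord_section[OF Suc.prems(1) j(1)])
  have fV: "f y \<in> carrier F" if "y \<in> V" for y
    using poly_deg_closed[OF Suc.prems(3)] V(1) that by blast
  have cardW: "card W = ?q ^ m" using Suc.prems(2) line(5) card_carrier_gt_1 by simp
  have fl: "f (line_through n e y t) \<in> carrier F" if "y \<in> W" "t \<in> carrier F" for y t
    using fV line(1) that by blast
  have "(\<Oplus>y\<in>V. f y) = (\<Oplus>y\<in>(\<Union>y\<in>W. line_through n e y ` carrier F). f y)"
    using line(4) by simp
  also have "\<dots> = (\<Oplus>y\<in>W. \<Oplus>v\<in>line_through n e y ` carrier F. f v)"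
    using finW finite_carrier line(3) fl by (intro add.finprod_UN_disjoint) auto
  also have "\<dots> = (\<Oplus>y\<in>W. \<Oplus>t\<in>carrier F. t [^] (0::nat) \<otimes> f (line_through n e y t))"
  proof (intro finsum_cong' refl)
    fix y assume y: "y \<in> W"
    have "(\<Oplus>v\<in>line_through n e y ` carrier F. f v) = (\<Oplus>t\<in>carrier F. f (line_through n e y t))"
      using line(2)[OF y] fl[OF y] by (intro finsum_reindex) auto
    also have "\<dots> = (\<Oplus>t\<in>carrier F. t [^] (0::nat) \<otimes> f (line_through n e y t))"
      using fl[OF y] by (intro finsum_cong') auto
    finally show "(\<Oplus>v\<in>line_through n e y ` carrier F. f v) =
      (\<Oplus>t\<in>carrier F. t [^] (0::nat) \<otimes> f (line_through n e y t))" .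
  qed (use fl in \<open>auto intro!: finsum_closed\<close>)
  also have "\<dots> = \<zero>"
  proof -
    let ?g = "\<lambda>y. \<Oplus>t\<in>carrier F. t [^] (0::nat) \<otimes> f (line_through n e y t)"
    have red: "reduced_deg n N ?g"
      using reduced_deg_line_sum[OF Suc.prems(3) V(1)[OF e(1)], of 0]
      by (simp only: line_through_def add_0_right)
    show ?thesis
    proof (cases "N < ?q - 1")
      case True
      then have "?g y = \<zero>" if "y \<in> W" for y
        using red that \<open>W \<subseteq> words F n\<close> unfolding reduced_deg_def by auto
      then show ?thesis by (rule add.finprod_one_eqI)
    next
      case False
      then have "poly_deg n (N - (?q - 1)) ?g" using red unfolding reduced_deg_def by simp
      moreover have "N - (?q - 1) < m * (?q - 1)" using Suc.prems(4) False by simp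
      ultimately show ?thesis using Suc.IH[OF subW cardW] by blast
    qed
  qed
  finally show ?case .
qed simp

lemma poly_deg_prod:
  assumes "finite S" "S \<subseteq> {..<n}" "\<And>i. i \<in> S \<Longrightarrow> a i \<in> carrier F"
  shows "poly_deg n (card S) (\<lambda>y. \<Otimes>i\<in>S. \<one> \<oplus> a i \<otimes> y i)"
  using assms
proof (induction S)
  case empty
  then show ?case by (simp add: poly_deg.const)
next
  case (insert j S)
  let ?P = "\<lambda>y. \<Otimes>i\<in>S. \<one> \<oplus> a i \<otimes> y i"
  have IH: "poly_deg n (card S) ?P" using insert by simp
  have j: "j < n" "a j \<in> carrier F" using insert.prems by auto
  have "poly_deg n (Suc (card S)) (\<lambda>y. ?P y \<oplus> a j \<otimes> (y j \<otimes> ?P y))"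
    by (intro poly_deg.add poly_deg_smult poly_deg.coord j IH poly_deg.weaken[OF IH]) simp
  then have "poly_deg n (Suc (card S)) (\<lambda>y. \<Otimes>i\<in>insert j S. \<one> \<oplus> a i \<otimes> y i)"
  proof (rule poly_deg.ext)
    fix y assume y: "y \<in> words F n"
    have yi: "\<one> \<oplus> a i \<otimes> y i \<in> carrier F" if "i \<in> insert j S" for i
      using insert.prems that y by (auto simp: PiE_iff)
    have yj: "y j \<in> carrier F" using y j by (auto simp: PiE_iff)
    have "?P y \<in> carrier F" using yi by (intro finprod_closed) auto
    moreover have "(\<Otimes>i\<in>insert j S. \<one> \<oplus> a i \<otimes> y i) = (\<one> \<oplus> a j \<otimes> y j) \<otimes> ?P y"
      using insert.hyps yi by (intro finprod_insert) auto
    ultimately show "?P y \<oplus> a j \<otimes> (y j \<otimes> ?P y) = (\<Otimes>i\<in>insert j S. \<one> \<oplus> a i \<otimes> y i)"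
      using j yj by (simp add: l_distr m_assoc)
  qed
  then show ?case using insert.hyps by simp
qed

lemma minimal_codeword_support:
  assumes "minimal_code F n C" "c \<in> C" "c \<noteq> (\<lambda>i\<in>{..<n}. \<zero>)"
    and "c' \<in> C" "c' \<noteq> (\<lambda>i\<in>{..<n}. \<zero>)" "support F n c' \<subseteq> support F n c"
  shows "support F n c' = support F n c"
  using assms unfolding minimal_code_def minimal_codeword_def word_space_simps by blast

text \<open>With \<open>c\<close> a codeword and \<open>i\<^sub>0\<close> in its support, minimality forces every nonzero codeword
  vanishing at \<open>i\<^sub>0\<close> to agree with \<open>c\<close> somewhere on the support.  The product of the
  \<open>1 - y\<^sub>i / c\<^sub>i\<close> is therefore the indicator of \<open>0\<close> on a subspace of codimension one, so that its
  degree cannot be small (Jamison's argument).\<close>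

lemma minimal_code_weight:
  assumes C: "subspace_of_words n C" "card C = card (carrier F) ^ k" and min: "minimal_code F n C"
    and c: "c \<in> C" "c \<noteq> (\<lambda>i\<in>{..<n}. \<zero>)"
  shows "(card (carrier F) - 1) * (k - 1) + 1 \<le> card (support F n c)"
proof (rule ccontr)
  assume contra: "\<not> ?thesis"
  let ?q = "card (carrier F)"
  note CD = subspace_of_wordsD[OF C(1)]
  have cC: "c i \<in> carrier F" if "i < n" for i using CD(5)[OF c(1) that] .
  obtain j where j: "j < n" "c j \<noteq> \<zero>" using nonzero_coord[OF CD(1)[OF c(1)] c(2)] by blast
  \<comment> \<open>The factor at \<open>j\<close> would be constantly 1 on \<open>W\<close>;
    leaving it out lowers the degree by one, which is the \<open>+ 1\<close> in the bound.\<close>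
  define S where "S = support F n c - {j}"
  have fin: "finite (support F n c)" by (simp add: support_def)
  have "j \<in> support F n c" using j by (simp add: support_def)
  then have "card (support F n c) = Suc (card S)" unfolding S_def using card_Suc_Diff1[OF fin] by simp
  then have small: "card S < (k - 1) * (?q - 1)" using contra by (simp add: mult.commute)
  then obtain m where k: "k = Suc m" by (cases k) auto
  define W where "W = coord_section j C"
  have subW: "subspace_of_words n W"
    unfolding W_def by (rule subspace_coord_section[OF C(1) j(1)])
  obtain e where e: "e \<in> C" "e j = \<one>" using normalize_coord[OF C(1) c(1) j] .
  have cardW: "card W = ?q ^ m"
    using card_coord_section[OF C(1) e(1) j(1) e(2)] C(2) k card_carrier_gt_1 by (simp add: W_def)
  have "W \<subseteq> words F n" using subspace_of_wordsD(1)[OF subW] by blast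
  then have finW: "finite W" using finite_words[of n] by (rule finite_subset)
  define a where "a i = \<ominus> (inv (c i))" for i
  have SD: "i < n \<and> c i \<noteq> \<zero> \<and> c i \<in> carrier F \<and> inv (c i) \<in> carrier F" if "i \<in> S" for i
    using that cC by (auto simp: S_def support_def field_Units)
  define f where "f y = (\<Otimes>i\<in>S. \<one> \<oplus> a i \<otimes> y i)" for y
  have finS: "finite S" using fin by (simp add: S_def)
  have "poly_deg n (card S) f"
    unfolding f_def using SD finS by (intro poly_deg_prod) (auto simp: a_def)
  then have "(\<Oplus>y\<in>W. f y) = \<zero>"
    using small k by (intro sum_poly_deg_eq_zero[OF subW cardW]) auto
  moreover have "f y = (if y = (\<lambda>i\<in>{..<n}. \<zero>) then \<one> else \<zero>)" if y: "y \<in> W" for y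
  proof (cases "y = (\<lambda>i\<in>{..<n}. \<zero>)")
    case True
    then show ?thesis unfolding f_def using SD by (auto simp: a_def intro!: finprod_one_eqI)
  next
    case False
    have yC: "y \<in> C" "y j = \<zero>" using y by (auto simp: W_def coord_section_def)
    have yc: "y i \<in> carrier F" if "i < n" for i using CD(5)[OF yC(1) that] .
    define z where "z = (\<lambda>i\<in>{..<n}. c i \<oplus> (\<ominus> \<one>) \<otimes> y i)"
    have z: "z \<in> C" unfolding z_def by (rule subspace_of_words_lincomb[OF C(1) c(1) yC(1)]) simp
    have z_at: "z i = c i \<ominus> y i" if "i < n" for i
      using that yc[OF that] cC[OF that] by (simp add: z_def l_minus minus_eq)
    have "z j = c j" using z_at[OF j(1)] yC cC[OF j(1)] by (simp add: minus_eq)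
    then have z0: "z \<noteq> (\<lambda>i\<in>{..<n}. \<zero>)" using j by auto
    \<comment> \<open>Otherwise minimality of \<open>z = c - y\<close> gives \<open>z\<close> and
      \<open>c\<close> the same support, which then contains that of \<open>y\<close>; minimality of
      \<open>c\<close> makes these equal too, contradicting \<open>y j = \<zero>\<close>.\<close>
    have "\<exists>i\<in>support F n c. z i = \<zero>"
    proof (rule ccontr)
      assume "\<not> ?thesis"
      then have "support F n c \<subseteq> support F n z" by (auto simp: support_def)
      then have eq: "support F n c = support F n z"
        by (rule minimal_codeword_support[OF min z z0 c])
      have "support F n y \<subseteq> support F n c"
      proof
        fix i assume i: "i \<in> support F n y"
        then have i': "i < n" "y i \<noteq> \<zero>" by (auto simp: support_def)
        show "i \<in> support F n c"
        proof (rule ccontr)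
          assume "i \<notin> support F n c"
          then have "c i = \<zero>" "z i = \<zero>" using eq i' by (auto simp: support_def)
          then show False using z_at[OF i'(1)] yc[OF i'(1)] i' by (simp add: minus_eq)
        qed
      qed
      then have "support F n y = support F n c"
        by (rule minimal_codeword_support[OF min c yC(1) False])
      then show False using \<open>j \<in> support F n c\<close> yC by (auto simp: support_def)
    qed
    then obtain i where i: "i \<in> support F n c" "z i = \<zero>" by blast
    have "i \<noteq> j" using i \<open>z j = c j\<close> j by auto
    then have iS: "i \<in> S" using i by (simp add: S_def)
    note Di = SD[OF iS]
    have "c i \<ominus> y i = \<zero>" using z_at[of i] i(2) Di by simp
    then have "c i = y i" using Di yc[of i] by (simp only: r_right_minus_eq)
    then have "\<one> \<oplus> a i \<otimes> y i = \<zero>" using Di by (simp add: a_def l_minus field_Units r_neg)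
    moreover have "f y = (\<one> \<oplus> a i \<otimes> y i) \<otimes> (\<Otimes>i\<in>S-{i}. \<one> \<oplus> a i \<otimes> y i)"
    proof -
      have cl: "\<one> \<oplus> a l \<otimes> y l \<in> carrier F" if "l \<in> S" for l
        using SD[OF that] yc by (simp add: a_def)
      have "f y = (\<Otimes>i\<in>insert i (S-{i}). \<one> \<oplus> a i \<otimes> y i)" unfolding f_def using iS by (simp add: insert_absorb)
      also have "\<dots> = (\<one> \<oplus> a i \<otimes> y i) \<otimes> (\<Otimes>i\<in>S-{i}. \<one> \<oplus> a i \<otimes> y i)"
        using finS cl iS by (intro finprod_insert) auto
      finally show ?thesis .
    qed
    moreover have "(\<Otimes>i\<in>S-{i}. \<one> \<oplus> a i \<otimes> y i) \<in> carrier F"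
      using SD yc by (intro finprod_closed) (auto simp: a_def)
    ultimately show ?thesis using False by simp
  qed
  then have "(\<Oplus>y\<in>W. f y) = (\<Oplus>y\<in>W. if y = (\<lambda>i\<in>{..<n}. \<zero>) then \<one> else \<zero>)"
    by (intro finsum_cong') auto
  moreover have "\<dots> = \<one>"
    using subspace_of_wordsD(2)[OF subW] finW by (intro add.finprod_singleton_swap) auto
  ultimately show False by simp
qed

section \<open>The bound for minimal codes\<close>

definition ip :: "nat \<Rightarrow> (nat \<Rightarrow> 'a) \<Rightarrow> (nat \<Rightarrow> 'a) \<Rightarrow> 'a" where
  "ip n c x = (\<Oplus>i\<in>{..<n}. c i \<otimes> x i)"

lemma words_coord: "x \<in> words F n \<Longrightarrow> i < n \<Longrightarrow> x i \<in> carrier F"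
  by (auto simp: PiE_iff)

lemma ip_closed: "c \<in> words F n \<Longrightarrow> x \<in> words F n \<Longrightarrow> ip n c x \<in> carrier F"
  unfolding ip_def by (intro finsum_closed) (auto simp: words_coord)

lemma ip_lincomb:
  assumes "c \<in> words F n" "e \<in> words F n" "x \<in> words F n" "t \<in> carrier F"
  shows "ip n (\<lambda>i\<in>{..<n}. c i \<oplus> t \<otimes> e i) x = ip n c x \<oplus> t \<otimes> ip n e x"
proof -
  note cl = words_coord[OF assms(1)] words_coord[OF assms(2)] words_coord[OF assms(3)] assms(4)
  have "ip n (\<lambda>i\<in>{..<n}. c i \<oplus> t \<otimes> e i) x = (\<Oplus>i\<in>{..<n}. c i \<otimes> x i \<oplus> t \<otimes> (e i \<otimes> x i))"
    unfolding ip_def using cl by (intro finsum_cong') (auto simp: l_distr m_assoc)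
  also have "\<dots> = ip n c x \<oplus> (\<Oplus>i\<in>{..<n}. t \<otimes> (e i \<otimes> x i))"
    unfolding ip_def using cl by (intro finsum_addf) auto
  also have "(\<Oplus>i\<in>{..<n}. t \<otimes> (e i \<otimes> x i)) = t \<otimes> ip n e x"
    unfolding ip_def using cl by (intro finsum_rdistr[symmetric]) auto
  finally show ?thesis .
qed

lemma ip_update:
  assumes c: "c \<in> words F n" and x: "x \<in> words F n" and i: "i < n" and b: "b \<in> carrier F"
  shows "ip n c (x(i := b)) = c i \<otimes> b \<oplus> (\<Oplus>l\<in>{..<n} - {i}. c l \<otimes> x l)"
proof -
  note cl = words_coord[OF c] words_coord[OF x]
  have "ip n c (x(i := b)) = (\<Oplus>l\<in>insert i ({..<n} - {i}). c l \<otimes> (x(i := b)) l)"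
    unfolding ip_def using i by (simp add: insert_absorb)
  also have "\<dots> = c i \<otimes> (x(i := b)) i \<oplus> (\<Oplus>l\<in>{..<n} - {i}. c l \<otimes> (x(i := b)) l)"
    using cl b i by (intro finsum_insert) auto
  also have "(\<Oplus>l\<in>{..<n} - {i}. c l \<otimes> (x(i := b)) l) = (\<Oplus>l\<in>{..<n} - {i}. c l \<otimes> x l)"
    using cl by (intro finsum_cong') auto
  finally show ?thesis by (simp only: fun_upd_same)
qed

text \<open>The map \<open>h c = ip n c x \<ominus> ip n c y\<close> is a nonzero linear functional
  on \<open>C\<close>; adding multiples of some \<open>e\<close> with \<open>h e = \<one>\<close>
  identifies kernel times field with \<open>C\<close>.\<close>

lemma card_ip_eq:
  assumes C: "subspace_of_words n C" and x: "x \<in> words F n" and y: "y \<in> words F n"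
    and c0: "c0 \<in> C" "ip n c0 x \<noteq> ip n c0 y"
  shows "card {c \<in> C. ip n c x = ip n c y} * card (carrier F) = card C"
proof -
  note CD = subspace_of_wordsD[OF C]
  define h where "h c = ip n c x \<ominus> ip n c y" for c
  have cl: "ip n c x \<in> carrier F" "ip n c y \<in> carrier F" if "c \<in> C" for c
    using ip_closed CD(1)[OF that] x y by blast+
  have hC: "h c \<in> carrier F" if "c \<in> C" for c unfolding h_def using cl[OF that] by simp
  have h0: "h c = \<zero> \<longleftrightarrow> ip n c x = ip n c y" if "c \<in> C" for c
    unfolding h_def using cl[OF that] by simp
  have h_lin: "h (\<lambda>i\<in>{..<n}. c i \<oplus> t \<otimes> e i) = h c \<oplus> t \<otimes> h e"
    if "c \<in> C" "e \<in> C" "t \<in> carrier F" for c e t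
    unfolding h_def ip_lincomb[OF CD(1)[OF that(1)] CD(1)[OF that(2)] x that(3)]
      ip_lincomb[OF CD(1)[OF that(1)] CD(1)[OF that(2)] y that(3)]
    using cl[OF that(1)] cl[OF that(2)] that(3)
    by (simp add: minus_eq minus_add r_distr r_minus a_ac)
  define e where "e = (\<lambda>i\<in>{..<n}. (\<lambda>i\<in>{..<n}. \<zero>) i \<oplus> inv (h c0) \<otimes> c0 i)"
  have "h c0 \<noteq> \<zero>" using h0[OF c0(1)] c0(2) by blast
  then have "h c0 \<in> Units F" using hC[OF c0(1)] field_Units by blast
  then have u: "inv (h c0) \<in> carrier F" "inv (h c0) \<otimes> h c0 = \<one>"
    by (rule Units_inv_closed, rule Units_l_inv)
  have e: "e \<in> C" unfolding e_def by (rule subspace_of_words_lincomb[OF C CD(2) c0(1) u(1)])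
  have "h (\<lambda>i\<in>{..<n}. \<zero>) = \<zero>"
  proof -
    have "ip n (\<lambda>i\<in>{..<n}. \<zero>) z = \<zero>" if "z \<in> words F n" for z
      unfolding ip_def using words_coord[OF that] by (intro add.finprod_one_eqI) simp
    then show ?thesis unfolding h_def using x y by (simp add: minus_eq)
  qed
  then have he: "h e = \<one>" unfolding e_def h_lin[OF CD(2) c0(1) u(1)] using u by simp
  let ?Z = "{c \<in> C. ip n c x = ip n c y}"
  let ?f = "\<lambda>(c, t). \<lambda>i\<in>{..<n}. c i \<oplus> t \<otimes> e i"
  let ?g = "\<lambda>c. (\<lambda>i\<in>{..<n}. c i \<oplus> (\<ominus> h c) \<otimes> e i, h c)"
  have eC: "e i \<in> carrier F" if "i < n" for i using CD(5)[OF e that] .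
  have f: "?f (c, t) \<in> C" "h (?f (c, t)) = t" if "c \<in> ?Z" "t \<in> carrier F" for c t
  proof -
    have c: "c \<in> C" using that(1) by blast
    then have "h c = \<zero>" using h0 that(1) by blast
    then show "?f (c, t) \<in> C" "h (?f (c, t)) = t"
      using subspace_of_words_lincomb[OF C c e that(2)] h_lin[OF c e that(2)] he that(2) by simp_all
  qed
  have "bij_betw ?f (?Z \<times> carrier F) C"
  proof (rule bij_betw_byWitness[where f' = ?g])
    show "\<forall>p\<in>?Z \<times> carrier F. ?g (?f p) = p"
    proof
      fix p assume "p \<in> ?Z \<times> carrier F"
      then obtain c t where p: "p = (c, t)" "c \<in> ?Z" "t \<in> carrier F" by blast
      have "(\<lambda>i\<in>{..<n}. ?f (c, t) i \<oplus> (\<ominus> t) \<otimes> e i) = c"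
      proof
        fix i
        have "c \<in> words F n" using CD(1) p(2) by blast
        then show "(\<lambda>i\<in>{..<n}. ?f (c, t) i \<oplus> (\<ominus> t) \<otimes> e i) i = c i"
          using eC[of i] p(3) words_coord[of c n i]
          by (cases "i < n") (auto simp: a_assoc l_minus r_neg PiE_iff extensional_def)
      qed
      then show "?g (?f p) = p" using f(2)[OF p(2,3)] p(1) by simp
    qed
    show "\<forall>c\<in>C. ?f (?g c) = c"
    proof
      fix c assume c: "c \<in> C"
      show "?f (?g c) = c"
      proof
        fix i
        show "?f (?g c) i = c i"
          using eC[of i] hC[OF c] CD(5)[OF c, of i] CD(1)[OF c]
          by (cases "i < n") (auto simp: a_assoc l_minus l_neg PiE_iff extensional_def)
      qed
    qed
    show "?f ` (?Z \<times> carrier F) \<subseteq> C" using f(1) by blast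
    show "?g ` C \<subseteq> ?Z \<times> carrier F"
    proof
      fix p assume "p \<in> ?g ` C"
      then obtain c where c: "c \<in> C" "p = ?g c" by blast
      have m: "\<ominus> h c \<in> carrier F" using hC[OF c(1)] by simp
      have "(\<lambda>i\<in>{..<n}. c i \<oplus> (\<ominus> h c) \<otimes> e i) \<in> C"
        by (rule subspace_of_words_lincomb[OF C c(1) e m])
      moreover have "h (\<lambda>i\<in>{..<n}. c i \<oplus> (\<ominus> h c) \<otimes> e i) = \<zero>"
        unfolding h_lin[OF c(1) e m] he using hC[OF c(1)] by (simp add: r_neg)
      ultimately show "p \<in> ?Z \<times> carrier F" using h0 hC[OF c(1)] c(2) by auto
    qed
  qed
  then have "card (?Z \<times> carrier F) = card C" by (rule bij_betw_same_card)
  then show ?thesis by (simp only: card_cartesian_product)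
qed

lemma code_pairing_words:
  assumes C: "subspace_of_words n C"
    and d: "\<And>c. c \<in> C \<Longrightarrow> c \<noteq> (\<lambda>i\<in>{..<n}. \<zero>) \<Longrightarrow> d \<le> card (support F n c)"
  shows "code_pairing n (carrier F) (words F n) C (ip n) (\<lambda>c i. c i \<noteq> \<zero>) (\<lambda>i\<in>{..<n}. \<zero>) d"
proof
  note CD = subspace_of_wordsD[OF C]
  show "finite (carrier F)" "finite (words F n)" by (rule finite_carrier finite_words)+
  have "C \<subseteq> words F n" using CD(1) by blast
  then show "finite C" using finite_words by (rule finite_subset)
  show "card (carrier F) > 1" by (rule card_carrier_gt_1)
  show "x i \<in> carrier F" if "x \<in> words F n" "i < n" for x i using that by (rule words_coord)
  show upd: "x(i := b) \<in> words F n" if "x \<in> words F n" "i < n" "b \<in> carrier F" for x i b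
    using that by (auto simp: PiE_iff extensional_def)
  show "ip n c x \<in> carrier F" if "c \<in> C" "x \<in> words F n" for c x
    using that CD(1) by (intro ip_closed)
  show "card {c \<in> C. ip n c x = ip n c y} * card (carrier F) = card C"
    if "x \<in> words F n" "y \<in> words F n" "c \<in> C" "ip n c x \<noteq> ip n c y" for x y c
    using that by (rule card_ip_eq[OF C])
  show "card {b \<in> carrier F. ip n c (x(i := b)) = v} = 1"
    if c: "c \<in> C" and x: "x \<in> words F n" and i: "i < n" and nz: "c i \<noteq> \<zero>" and v: "v \<in> carrier F" for c x i v
  proof -
    define R where "R = (\<Oplus>l\<in>{..<n} - {i}. c l \<otimes> x l)"
    have R: "R \<in> carrier F"
      unfolding R_def using words_coord[OF CD(1)[OF c]] words_coord[OF x] by (intro finsum_closed) auto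
    have ci: "c i \<in> carrier F" using CD(5)[OF c i] .
    have up: "ip n c (x(i := b)) = c i \<otimes> b \<oplus> R" if "b \<in> carrier F" for b
      unfolding R_def using ip_update[OF CD(1)[OF c] x i that] .
    have inj: "inj_on (\<lambda>b. c i \<otimes> b \<oplus> R) (carrier F)"
      using ci R nz by (intro inj_onI) (simp add: m_lcancel)
    then have "(\<lambda>b. c i \<otimes> b \<oplus> R) ` carrier F = carrier F"
      using ci R finite_carrier by (intro endo_inj_surj) auto
    then have "v \<in> (\<lambda>b. c i \<otimes> b \<oplus> R) ` carrier F" using v by simp
    then obtain b where b: "b \<in> carrier F" "v = c i \<otimes> b \<oplus> R" by (rule imageE)
    have "{b \<in> carrier F. ip n c (x(i := b)) = v} = {b}"
    proof (intro equalityI subsetI)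
      fix b' assume "b' \<in> {b \<in> carrier F. ip n c (x(i := b)) = v}"
      then have "b' \<in> carrier F" "c i \<otimes> b' \<oplus> R = c i \<otimes> b \<oplus> R" using up b(2) by auto
      then show "b' \<in> {b}" using inj_onD[OF inj _ _ b(1)] by simp
    qed (use b up in simp)
    then show ?thesis by simp
  qed
  show "ip n c (x(i := b)) = ip n c x"
    if c: "c \<in> C" and x: "x \<in> words F n" and i: "i < n" and z: "\<not> c i \<noteq> \<zero>" and b: "b \<in> carrier F" for c x i b
    using ip_update[OF CD(1)[OF c] x i b] ip_update[OF CD(1)[OF c] x i words_coord[OF x i]] z b
      words_coord[OF x i] by simp
  show "(\<lambda>i\<in>{..<n}. \<zero>) \<in> C" by (rule CD(2))
  show "ip n (\<lambda>i\<in>{..<n}. \<zero>) x = ip n (\<lambda>i\<in>{..<n}. \<zero>) y" if "x \<in> words F n" "y \<in> words F n" for x y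
  proof -
    have "ip n (\<lambda>i\<in>{..<n}. \<zero>) z = \<zero>" if "z \<in> words F n" for z
      unfolding ip_def using words_coord[OF that] by (intro add.finprod_one_eqI) simp
    then show ?thesis using that by simp
  qed
  show "d \<le> card {i \<in> {..<n}. c i \<noteq> \<zero>}" if "c \<in> C" "c \<noteq> (\<lambda>i\<in>{..<n}. \<zero>)" for c
    using d[OF that] by (simp add: support_def)
qed

text \<open>Hypothesis \<open>l\<close> is the gap condition of the linear programming bound, for
  the distance from \<open>minimal_code_weight\<close> and the eigenvalue from
  \<open>radial_eigenfunction\<close>.\<close>

lemma minimal_code_card_le:
  fixes n k r m :: nat and y q :: real
  assumes C: "subspace_of_words n C" "card C = card (carrier F) ^ k" and min: "minimal_code F n C"
    and k: "1 \<le> k" and m: "1 \<le> m" "m < r" and r: "r < n" and y: "0 < y" "y \<le> 1"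
  defines "q \<equiv> real (card (carrier F))"
  assumes l: "(q - 1) * n - q * ((q - 1) * (real k - 1) + 1) + 1 \<le> (real r - m) * (q - 2) +
      2 * (1 - m / r) * sqrt ((q - 1) * r * (real n - r)) * cos (pi / (real m + 1))"
  shows "q ^ k \<le> q * n * ((1 + (q - 1) * y) ^ n / y ^ r)"
proof -
  define d where "d = (card (carrier F) - 1) * (k - 1) + 1"
  have d: "d \<le> card (support F n c)" if "c \<in> C" "c \<noteq> (\<lambda>i\<in>{..<n}. \<zero>)" for c
    unfolding d_def using minimal_code_weight[OF C min that] .
  have q: "2 \<le> q" using card_carrier_gt_1 by (simp add: q_def)
  have dq: "real d = (q - 1) * (real k - 1) + 1"
    using k card_carrier_gt_1 by (simp add: d_def q_def of_nat_diff)
  interpret code_pairing n "carrier F" "words F n" C "ip n" "\<lambda>c i. c i \<noteq> \<zero>" "\<lambda>i\<in>{..<n}. \<zero>" d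
    using C(1) d by (rule code_pairing_words)
  define l' where "l' = (real r - m) * (q - 2) +
      2 * (1 - m / r) * sqrt ((q - 1) * r * (real n - r)) * cos (pi / (real m + 1))"
  obtain g :: "nat \<Rightarrow> real" where g: "\<And>w. 0 \<le> g w" "\<And>w. r < w \<Longrightarrow> g w = 0" "0 < g r"
    "\<And>w. w \<le> n \<Longrightarrow> l' * g w \<le> w * g (w - 1) + w * (q - 2) * g w + (real n - w) * (q - 1) * g (Suc w)"
    using radial_eigenfunction[OF q m r] unfolding l'_def by metis
  let ?wt = "wt \<zero> n"
  let ?B = "{x \<in> words F n. ?wt x \<le> r}"
  \<comment> \<open>A word of weight \<open>r\<close>, where \<open>g\<close> is positive: the test
    function is not zero.\<close>
  define z where "z = (\<lambda>i\<in>{..<n}. if i < r then \<one> else \<zero>)"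
  have "{i \<in> {..<n}. z i \<noteq> \<zero>} = {..<r}" using r by (auto simp: z_def)
  then have "?wt z = r" by (simp add: wt_def)
  have "card C \<le> q * d * card ?B"
    unfolding q_def
  proof (rule linear_programming_bound[where f = "\<lambda>x. g (?wt x)" and z = z and l = l'])
    show "0 \<le> g (?wt x)" for x by (rule g)
    show "?B \<subseteq> words F n" by blast
    show "g (?wt x) = 0" if "x \<in> words F n" "x \<notin> ?B" for x using that g(2) by simp
    show "z \<in> words F n" by (simp add: z_def restrict_PiE_iff)
    show "0 < g (?wt z)" using g(3) \<open>?wt z = r\<close> by simp
    show "(l' + n) * g (?wt x) \<le> (\<Sum>i<n. \<Sum>b\<in>carrier F. g (?wt (x(i := b))))" for x
      unfolding sum_radial_update[OF finite_carrier zero_closed] q_def[symmetric]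
      using g(4)[OF wt_le[of \<zero> n x]] by (simp add: algebra_simps)
    show "(real (card (carrier F)) - 1) * n - real (card (carrier F)) * d + 1 \<le> l'"
      using l unfolding l'_def dq q_def[symmetric] by simp
  qed
  also have "\<dots> \<le> q * n * ((1 + (q - 1) * y) ^ n / y ^ r)"
  proof (intro mult_mono)
    \<comment> \<open>A nonzero codeword exists because \<open>k \<ge> 1\<close>, and its weight
      shows \<open>d \<le> n\<close>.\<close>
    have "card {\<lambda>i\<in>{..<n}. \<zero>} < card C"
      unfolding C(2) using one_less_power[OF card_carrier_gt_1, of k] k by simp
    then have "\<not> C \<subseteq> {\<lambda>i\<in>{..<n}. \<zero>}" using card_mono[of "{\<lambda>i\<in>{..<n}. \<zero>}" C] by auto
    then obtain c where "c \<in> C" "c \<noteq> (\<lambda>i\<in>{..<n}. \<zero>)" by blast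
    then have "d \<le> card (support F n c)" by (rule d)
    also have "\<dots> \<le> card {..<n}" by (intro card_mono) (auto simp: support_def)
    finally show "real d \<le> real n" by simp
    show "real (card ?B) \<le> (1 + (q - 1) * y) ^ n / y ^ r"
      unfolding q_def using finite_carrier y by (intro card_ball_le) auto
  qed (use q y in auto)
  finally show ?thesis by (simp add: C(2) q_def)
qed

end

section \<open>Choice of parameters and conclusion\<close>

text \<open>For \<open>E = 1521/1000\<close> the condition \<open>(E - c)\<^sup>2 < 4 c\<close>
  needs \<open>c\<close> above about 0.3455. From \<open>q = 3\<close> on \<open>c = 7/20\<close>
  works; for \<open>q = 2\<close> it would break the entropy condition for every \<open>y\<close>,
  so \<open>c = 346/1000\<close> is taken, which makes \<open>rho\<close> equal to
  \<open>173/3521\<close>, with \<open>1/20\<close> as rounded Chernoff parameter.\<close>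

lemma code_parameters:
  fixes q :: nat
  assumes q: "2 \<le> q"
  obtains rho y :: real where "0 < rho" "rho < 1" "0 < y" "y \<le> 1"
    "(q - 1) * (1521 / 1000) / (q + 1521 / 1000) < (real q - 2) * rho + 2 * sqrt ((real q - 1) * rho * (1 - rho))"
    "ln (1 + (real q - 1) * y) - rho * ln y < ln q / (q + 1521 / 1000)"
proof (cases "q = 2")
  case True
  show ?thesis
  proof (rule that[of "173 / 3521" "1 / 20"])
    show "(q - 1) * (1521 / 1000) / (q + 1521 / 1000) <
        (real q - 2) * (173 / 3521) + 2 * sqrt ((real q - 1) * (173 / 3521) * (1 - 173 / 3521))"
      using spectral_inequality[of 2 "1521 / 1000" "346 / 1000"] True by (simp add: power2_eq_square)
    show "ln (1 + (real q - 1) * (1 / 20)) - 173 / 3521 * ln (1 / 20) < ln q / (q + 1521 / 1000)"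
      using entropy_inequality_2 True by simp
  qed simp_all
next
  case False
  then have q3: "3 \<le> q" using q by simp
  define y :: real where "y = (7 / 20) / (q * (q + 1521 / 1000))"
  have "1 * 1 \<le> real q * (q + 1521 / 1000)" using q3 by (intro mult_mono) auto
  then have y1: "0 < y" "y \<le> 1" using q3 by (simp_all add: y_def divide_le_eq)
  show ?thesis
  proof (rule that[of "(real q - 1) * y" y])
    show "0 < (real q - 1) * y" using q3 y1 by simp
    have "(real q - 1) * y = (7 / 20) * ((real q - 1) / (q * (q + 1521 / 1000)))" by (simp add: y_def)
    also have "(real q - 1) / (q * (q + 1521 / 1000)) \<le> 1"
    proof -
      have "real q * 1 \<le> q * (q + 1521 / 1000)" using q3 by (intro mult_left_mono) auto
      then have "real q - 1 \<le> q * (q + 1521 / 1000)" by linarith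
      then show ?thesis using q3 by (subst divide_le_eq_1_pos) auto
    qed
    finally show "(real q - 1) * y < 1" by simp
    have "(real q - 1) * y = (real q - 1) * (7 / 20) / (q * (q + 1521 / 1000))" by (simp add: y_def)
    then show "(q - 1) * (1521 / 1000) / (q + 1521 / 1000) <
        (real q - 2) * ((real q - 1) * y) + 2 * sqrt ((real q - 1) * ((real q - 1) * y) * (1 - (real q - 1) * y))"
      using spectral_inequality[of q "1521 / 1000" "7 / 20"] q3 by (simp add: power2_eq_square of_nat_diff)
    show "ln (1 + (real q - 1) * y) - (real q - 1) * y * ln y < ln q / (q + 1521 / 1000)"
      unfolding y_def by (rule entropy_inequality[OF q3])
  qed (use y1 in auto)
qed

text \<open>A violation means \<open>k > n / (q + 1521/1000)\<close>. A larger \<open>k\<close> only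
  weakens the gap condition to be met and enlarges the code, so the estimates at the extremal ratio
  contradict \<open>minimal_code_card_le\<close>.\<close>

lemma min_code_length_ge:
  fixes q :: nat
  assumes q: "2 \<le> q"
  shows "\<exists>k\<^sub>0\<ge>1. \<forall>F :: 'a ring. field F \<and> card (carrier F) = q \<longrightarrow>
    (\<forall>k\<ge>k\<^sub>0. (real q + 1521 / 1000) * k \<le> min_code_length k F)"
proof -
  let ?E = "1521 / 1000 :: real"
  obtain rho y :: real where rho: "0 < rho" "rho < 1" and y: "0 < y" "y \<le> 1"
    and ineqs: "(q - 1) * ?E / (q + ?E) < (real q - 2) * rho + 2 * sqrt ((real q - 1) * rho * (1 - rho))"
    "ln (1 + (real q - 1) * y) - rho * ln y < ln q / (q + ?E)"
    using code_parameters[OF q] .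
  obtain m n0 where m: "1 \<le> m" and n0: "\<And>n. n0 \<le> n \<Longrightarrow>
      m < nat \<lfloor>rho * real n\<rfloor> \<and> nat \<lfloor>rho * real n\<rfloor> < n \<and>
      (real q - 1) * n - q * ((real q - 1) * (n / (q + ?E) - 1) + 1) + 1 \<le>
        (real (nat \<lfloor>rho * real n\<rfloor>) - m) * (real q - 2) + 2 * (1 - m / nat \<lfloor>rho * real n\<rfloor>) *
          sqrt ((real q - 1) * nat \<lfloor>rho * real n\<rfloor> * (real n - nat \<lfloor>rho * real n\<rfloor>)) * cos (pi / (real m + 1)) \<and>
      ln (q * real n) + n * ln (1 + (real q - 1) * y) - nat \<lfloor>rho * real n\<rfloor> * ln y < n * (ln q / (q + ?E))"
    using eventually_parameters[OF q _ rho y ineqs] unfolding eventually_sequentially by auto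
  show ?thesis
  proof (intro exI[of _ "max 1 n0"] conjI allI impI)
    fix F :: "'a ring" and k
    assume F: "field F \<and> card (carrier F) = q" and k: "max 1 n0 \<le> k"
    then have card_F: "card (carrier F) = q" by blast
    have "finite (carrier F)" using F q by (intro card_ge_0_finite) auto
    then interpret finite_field F
      using F by (simp add: finite_field_def finite_field_axioms_def)
    define n where "n = min_code_length k F"
    \<comment> \<open>\<open>LEAST\<close> is the length of an actual code only because some minimal
      code of dimension \<open>k\<close> exists.\<close>
    have "\<exists>C. linear_code F n k C \<and> minimal_code F n C"
      unfolding n_def min_code_length_def by (rule LeastI_ex[OF minimal_code_exists])
    then obtain C where C: "subspace_of_words n C" "card C = card (carrier F) ^ k" "minimal_code F n C"
      unfolding linear_code_iff by blast
    show "(real q + ?E) * k \<le> min_code_length k F"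
    proof (rule ccontr)
      assume "\<not> ?thesis"
      then have small: "n / (q + ?E) < k" by (simp add: n_def field_simps)
      have "C \<subseteq> words F n" using subspace_of_wordsD(1)[OF C(1)] by blast
      then have "card C \<le> card (words F n)" using finite_words by (intro card_mono)
      \<comment> \<open>Length is at least dimension, so a large \<open>k\<close> forces the large
        \<open>n\<close> that the asymptotics demand.\<close>
      then have "q ^ k \<le> q ^ n" using C(2) F by (simp add: card_PiE)
      then have "k \<le> n" using q by (metis less_le_trans one_less_numeral_iff power_le_imp_le_exp semiring_norm(76))
      then have n: "n0 \<le> n" "1 \<le> n" using k by auto
      define r where "r = nat \<lfloor>rho * real n\<rfloor>"
      note P = n0[OF n(1), folded r_def]
      have "(real q - 1) * n - q * ((real q - 1) * (real k - 1) + 1) + 1 \<le>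
          (real q - 1) * n - q * ((real q - 1) * (n / (q + ?E) - 1) + 1) + 1"
        using small q by (intro add_mono diff_mono mult_left_mono order_refl) auto
      also note P[THEN conjunct2, THEN conjunct2, THEN conjunct1]
      finally have l: "(real q - 1) * n - q * ((real q - 1) * (real k - 1) + 1) + 1 \<le>
          (real r - m) * (real q - 2) +
          2 * (1 - m / r) * sqrt ((real q - 1) * r * (real n - r)) * cos (pi / (real m + 1))" .
      have "m < r" "r < n" "1 \<le> k" using P k by auto
      then have "real q ^ k \<le> real q * real n * ((1 + (real q - 1) * y) ^ n / y ^ r)"
        using minimal_code_card_le[OF C, unfolded card_F, of m r y] m y l by blast
      then have "ln (real q ^ k) \<le> ln (real q * real n * ((1 + (real q - 1) * y) ^ n / y ^ r))"
        using q by (intro ln_mono) auto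
      also have "\<dots> = ln (q * real n) + n * ln (1 + (real q - 1) * y) - r * ln y"
      proof -
        have "0 < 1 + (real q - 1) * y" using q y by (simp add: add_pos_nonneg)
        moreover have "0 < real q * n" using q n by simp
        moreover have "0 < (1 + (real q - 1) * y) ^ n / y ^ r"
          using y \<open>0 < 1 + (real q - 1) * y\<close> by simp
        ultimately have "ln (real q * real n * ((1 + (real q - 1) * y) ^ n / y ^ r)) =
            ln (real q * real n) + ln ((1 + (real q - 1) * y) ^ n / y ^ r)"
          by (intro ln_mult_pos)
        moreover have "ln ((1 + (real q - 1) * y) ^ n / y ^ r) = n * ln (1 + (real q - 1) * y) - r * ln y"
          using y \<open>0 < 1 + (real q - 1) * y\<close> by (simp add: ln_div ln_realpow)
        ultimately show ?thesis by simp
      qed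
      also have "\<dots> < n * (ln q / (q + ?E))" using P by blast
      also have "\<dots> = n / (q + ?E) * ln q" by simp
      also have "\<dots> \<le> k * ln q" using small q by (intro mult_right_mono) auto
      finally show False using q by (simp add: ln_realpow)
    qed
  qed simp
qed

theorem theoremA:
  shows "\<exists>\<epsilon> :: nat \<Rightarrow> real.
    strict_mono_on {q. primepow q} \<epsilon> \<and>
    (\<forall>q. primepow q \<longrightarrow> 1.52 < \<epsilon> 2 \<and> \<epsilon> 2 \<le> \<epsilon> q \<and> \<epsilon> q \<le> sqrt 2 + 1 / 2) \<and>
    (\<forall>q. primepow q \<longrightarrow>
      (\<exists>k\<^sub>0\<ge>1. \<forall>F :: nat ring. field F \<and> card (carrier F) = q \<longrightarrow>
        (\<forall>k\<ge>k\<^sub>0. real (min_code_length k F) \<ge> (real q + \<epsilon> q) * real k)))"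
proof (intro exI[of _ "\<lambda>q :: nat. 1521 / 1000 - 1 / (1000 * real q)"] conjI allI impI)
  \<comment> \<open>The value at 2 is 1.5205 and the limit is 1.521; lowering the uniform constant
    by a decreasing amount makes the function strictly increasing.\<close>
  let ?\<epsilon> = "\<lambda>q :: nat. 1521 / 1000 - 1 / (1000 * real q) :: real"
  have ge2: "2 \<le> q" if "primepow q" for q :: nat using primepow_gt_Suc_0[OF that] by simp
  show "strict_mono_on {q. primepow q} ?\<epsilon>"
  proof (rule strict_mono_onI)
    fix p q :: nat assume "p \<in> {q. primepow q}" "p < q"
    then show "?\<epsilon> p < ?\<epsilon> q" using ge2[of p] by (simp add: frac_less2)
  qed
  fix q :: nat assume "primepow q"
  then have q: "2 \<le> q" by (rule ge2)
  show "1.52 < ?\<epsilon> 2" by simp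
  show "?\<epsilon> 2 \<le> ?\<epsilon> q" using q by (simp add: frac_le)
  have "14 / 10 \<le> sqrt 2" by (rule real_le_rsqrt) (simp add: power2_eq_square)
  moreover have "?\<epsilon> q \<le> 1521 / 1000" by simp
  ultimately show "?\<epsilon> q \<le> sqrt 2 + 1 / 2" by linarith
  obtain k0 where k0: "1 \<le> k0" "\<And>F :: nat ring. \<And>k. field F \<and> card (carrier F) = q \<Longrightarrow> k0 \<le> k \<Longrightarrow>
      (real q + 1521 / 1000) * k \<le> min_code_length k F"
    using min_code_length_ge[OF q, where 'a = nat] by blast
  show "\<exists>k\<^sub>0\<ge>1. \<forall>F :: nat ring. field F \<and> card (carrier F) = q \<longrightarrow>
      (\<forall>k\<ge>k\<^sub>0. real (min_code_length k F) \<ge> (real q + ?\<epsilon> q) * real k)"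
  proof (intro exI[of _ k0] conjI allI impI k0(1))
    fix F :: "nat ring" and k
    assume F: "field F \<and> card (carrier F) = q" "k0 \<le> k"
    have "(real q + ?\<epsilon> q) * real k \<le> (real q + 1521 / 1000) * k" by (intro mult_right_mono) auto
    also have "\<dots> \<le> min_code_length k F" using F by (rule k0(2))
    finally show "(real q + ?\<epsilon> q) * real k \<le> real (min_code_length k F)" .
  qed
qed

end
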